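(* Let $\mathcal K$ be a non-empty subset of $\mathbb{C}$ invariant under complex conjugation. The following assertions hold. (a) The set $\mathcal{S}(\Omega_{\mathcal K},\mathbb{H})$ of continuous slice functions, equipped with the pointwise sum, with the left and right scalar multiplications $q\cdot f:=c_q\cdot f$ and $f\cdot q:=f\cdot c_q$ ($q\in\mathbb{H}$, $c_q$ the function on $\Omega_{\mathcal K}$ constantly equal to $q$, the products on the right-hand sides being slice products), with the slice product, with the $^*$-involution $f\mapsto f^*$ and with the supremum norm $\|f\|_\infty=\sup_{q\in\Omega_{\mathcal K}}|f(q)|$, is a quaternionic two-sided Banach $C^*$-algebra with unity $1_{\Omega_{\mathcal K}}$ (the constant function $1$). (b) The set $\mathcal{S}_{\mathbb{R}}(\Omega_{\mathcal K},\mathbb{H})$ is a commutative real Banach unital $C^*$-subalgebra of $\mathcal{S}(\Omega_{\mathcal K},\mathbb{H})$. (c) Given $\jmath\in\mathbb{S}$, the set $\mathcal{S}_{\mathbb{C}_\jmath}(\Omega_{\mathcal K},\mathbb{H})$ is a commutative $\mathbb{C}_\jmath$-Banach unital $C^*$-subalgebra of $\mathcal{S}(\Omega_{\mathcal K},\mathbb{H})$. (d) The set $\mathcal{S}_c(\Omega_{\mathcal K},\mathbb{H})$ is a quaternionic two-sided Banach unital $C^*$-subalgebra of $\mathcal{S}(\Omega_{\mathcal K},\mathbb{H})$.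
   Context: $\mathbb{H}$ denotes the quaternions, with conjugation $q\mapsto\overline q$ and norm $|q|=\sqrt{q\overline q}$; $\mathbb{S}=\{q\in\mathbb{H}:q^2=-1\}$; $\mathbb{C}_\jmath=\{\alpha+\jmath\beta:\alpha,\beta\in\mathbb{R}\}$. $\Omega_{\mathcal K}:=\{\alpha+\jmath\beta:\alpha,\beta\in\mathbb{R},\ \alpha+i\beta\in\mathcal K,\ \jmath\in\mathbb{S}\}\subset\mathbb{H}$. Slice functions: a continuous stem function on $\mathcal K$ is $F=F_1+iF_2:\mathcal K\to\mathbb{H}\otimes_{\mathbb{R}}\mathbb{C}$ with $F_1,F_2:\mathcal K\to\mathbb{H}$ continuous, $F_1(\overline z)=F_1(z)$, $F_2(\overline z)=-F_2(z)$. It induces the continuous slice function $\mathcal I(F):\Omega_{\mathcal K}\to\mathbb{H}$, $\mathcal I(F)(\alpha+\jmath\beta)=F_1(\alpha+i\beta)+\jmath F_2(\alpha+i\beta)$, $\jmath\in\mathbb{S}$; $F$ is uniquely determined by $\mathcal I(F)$. $\mathcal{S}(\Omega_{\mathcal K},\mathbb{H})$ is the set of all continuous slice functions; $\mathcal{S}_{\mathbb{R}}(\Omega_{\mathcal K},\mathbb{H})$ the subset of those with $F_1,F_2$ real-valued; $\mathcal{S}_{\mathbb{C}_\jmath}(\Omega_{\mathcal K},\mathbb{H})$ those with $F_1,F_2$ valued in $\mathbb{C}_\jmath$; $\mathcal{S}_c(\Omega_{\mathcal K},\mathbb{H})$ those with $F_2\equiv0$. Slice product: $\mathcal I(F)\cdot\mathcal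 I(G):=\mathcal I\big((F_1G_1-F_2G_2)+i(F_1G_2+F_2G_1)\big)$. Involution: $\mathcal I(F)^*:=\mathcal I(\overline{F_1}-i\,\overline{F_2})$, where $\overline{F_h}(z):=\overline{F_h(z)}$ is the quaternionic conjugate. A quaternionic two-sided Banach $C^*$-algebra with unity $\mathbf 1$ is an abelian group $V$ with left and right scalar multiplications by $\mathbb{H}$ that are biadditive, associative ($q(pu)=(qp)u$, $(up)q=u(pq)$, $(qu)p=q(up)$), unital ($1u=u1=u$) and with $ru=ur$ for $r\in\mathbb{R}$; with an associative biadditive product satisfying $q(uv)=(qu)v$, $(uv)q=u(vq)$ and $u=\mathbf 1u=u\mathbf 1$; with an involution satisfying $(u^* )^*=u$, $(u+v)^*=u^*+v^*$, $(qu)^*=u^*\overline q$, $(uq)^*=\overline qu^*$, $(uv)^*=v^*u^*$; and with a norm $\|\cdot\|:V\to[0,\infty)$ such that $\|u\|=0$ iff $u=0$, $\|u+v\|\le\|u\|+\|v\|$, $\|qu\|=|q|\|u\|=\|uq\|$, $\|uv\|\le\|u\|\|v\|$, $\|\mathbf 1\|=1$, $\|u^*u\|=\|u\|^2$, complete for the induced metric. A quaternionic two-sided Banach unital $C^*$-subalgebra is a subset containing $\mathbf 1$ on which the restricted operations give such a structure. A real (resp. $\mathbb{C}_\jmath$-) Banach unital $C^*$-subalgebra is a subset containing $\mathbf 1$ on which the restricted operations, with scalars restricted to $\mathbb{R}$ (resp. to $\mathbb{C}_\jmath$, where left and right scalar multiplications by $\mathbb{C}_\jmath$ are required to coincide),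 give the corresponding structure. It is commutative if $uv=vu$ for all its elements.
   Formalization: The set K is additionally assumed compact; without this some continuous slice functions in each of the four sets have infinite supremum norm (for example f(q)=|q| when K is the complex plane, for all of (a)–(d)), so the assertions fail. *)

theory Defs
  imports "HOL-Analysis.Analysis" "HOL-Algebra.Ring"
begin

section \<open>Quaternions\<close>

datatype quat = Quat (qRe: real) (qI: real) (qJ: real) (qK: real)

lemma quat_eq_iff: "p = q \<longleftrightarrow> qRe p = qRe q \<and> qI p = qI q \<and> qJ p = qJ q \<and> qK p = qK q"
  by (cases p; cases q) simp

lemmas quat_eqI = quat_eq_iff[THEN iffD2]

instantiation quat :: ab_group_add
begin

definition "0 = Quat 0 0 0 0"
definition "p + q = Quat (qRe p + qRe q) (qI p + qI q) (qJ p + qJ q) (qK p + qK q)"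
definition "- q = Quat (- qRe q) (- qI q) (- qJ q) (- qK q)"
definition "p - q = Quat (qRe p - qRe q) (qI p - qI q) (qJ p - qJ q) (qK p - qK q)"

instance
  by standard
    (simp_all add: zero_quat_def plus_quat_def uminus_quat_def minus_quat_def)

end

lemma quat_add_simps [simp]:
  "qRe 0 = 0" "qI 0 = 0" "qJ 0 = 0" "qK 0 = 0"
  "qRe (p + q) = qRe p + qRe q" "qI (p + q) = qI p + qI q"
  "qJ (p + q) = qJ p + qJ q" "qK (p + q) = qK p + qK q"
  "qRe (- q) = - qRe q" "qI (- q) = - qI q" "qJ (- q) = - qJ q" "qK (- q) = - qK q"
  "qRe (p - q) = qRe p - qRe q" "qI (p - q) = qI p - qI q"
  "qJ (p - q) = qJ p - qJ q" "qK (p - q) = qK p - qK q"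
  by (simp_all add: zero_quat_def plus_quat_def uminus_quat_def minus_quat_def)

instantiation quat :: real_vector
begin

definition "r *\<^sub>R q = Quat (r * qRe q) (r * qI q) (r * qJ q) (r * qK q)"

instance
  by standard (simp_all add: scaleR_quat_def quat_eq_iff algebra_simps)

end

lemma quat_scaleR_simps [simp]:
  "qRe (r *\<^sub>R q) = r * qRe q" "qI (r *\<^sub>R q) = r * qI q"
  "qJ (r *\<^sub>R q) = r * qJ q" "qK (r *\<^sub>R q) = r * qK q"
  by (simp_all add: scaleR_quat_def)

instantiation quat :: real_algebra_1
begin

definition "1 = Quat 1 0 0 0"
definition "p * q = Quat
  (qRe p * qRe q - qI p * qI q - qJ p * qJ q - qK p * qK q)
  (qRe p * qI q + qI p * qRe q + qJ p * qK q - qK p * qJ q)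
  (qRe p * qJ q - qI p * qK q + qJ p * qRe q + qK p * qI q)
  (qRe p * qK q + qI p * qJ q - qJ p * qI q + qK p * qRe q)"

instance
  by standard (simp_all add: one_quat_def times_quat_def quat_eq_iff algebra_simps)

end

lemma quat_mult_simps [simp]:
  "qRe 1 = 1" "qI 1 = 0" "qJ 1 = 0" "qK 1 = 0"
  "qRe (p * q) = qRe p * qRe q - qI p * qI q - qJ p * qJ q - qK p * qK q"
  "qI (p * q) = qRe p * qI q + qI p * qRe q + qJ p * qK q - qK p * qJ q"
  "qJ (p * q) = qRe p * qJ q - qI p * qK q + qJ p * qRe q + qK p * qI q"
  "qK (p * q) = qRe p * qK q + qI p * qJ q - qJ p * qI q + qK p * qRe q"
  by (simp_all add: one_quat_def times_quat_def)

lemma quat_of_real_simps [simp]: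
  "qRe (of_real r) = r" "qI (of_real r) = 0" "qJ (of_real r) = 0" "qK (of_real r) = 0"
  by (simp_all add: of_real_def)

definition qcnj :: "quat \<Rightarrow> quat" where
  "qcnj q = Quat (qRe q) (- qI q) (- qJ q) (- qK q)"

lemma qcnj_simps [simp]:
  "qRe (qcnj q) = qRe q" "qI (qcnj q) = - qI q" "qJ (qcnj q) = - qJ q" "qK (qcnj q) = - qK q"
  by (simp_all add: qcnj_def)

instantiation quat :: real_inner
begin

definition "inner p q = qRe p * qRe q + qI p * qI q + qJ p * qJ q + qK p * qK q"
definition "norm q = sqrt (inner q (q::quat))"
definition "sgn q = q /\<^sub>R norm (q::quat)"
definition "dist p q = norm (p - q :: quat)"
definition [code del]:
  "(uniformity :: (quat \<times> quat) filter) = (INF e\<in>{0<..}. principal {(x, y). dist x y < e})"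
definition [code del]:
  "open (U :: quat set) \<longleftrightarrow> (\<forall>x\<in>U. eventually (\<lambda>(x', y). x' = x \<longrightarrow> y \<in> U) uniformity)"

instance
proof
  fix p q s :: quat and r :: real
  show "dist p q = norm (p - q)" by (rule dist_quat_def)
  show "sgn q = q /\<^sub>R norm q" by (rule sgn_quat_def)
  show "inner p q = inner q p"
    and "inner (p + q) s = inner p s + inner q s"
    and "inner (r *\<^sub>R p) q = r * inner p q"
    by (simp_all add: inner_quat_def algebra_simps)
  show "0 \<le> inner p p" by (simp add: inner_quat_def)
  show "inner p p = 0 \<longleftrightarrow> p = 0"
    by (auto simp add: inner_quat_def quat_eq_iff add_nonneg_eq_0_iff)
  show "norm p = sqrt (inner p p)" by (rule norm_quat_def)
qed (rule uniformity_quat_def open_quat_def)+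

end

lemma mult_qcnj: "q * qcnj q = of_real ((norm q)\<^sup>2)"
  by (simp add: quat_eq_iff norm_quat_def inner_quat_def)

lemma norm_quat_eq: "norm q = sqrt (qRe (q * qcnj q))"
  by (simp add: mult_qcnj del: of_real_power)

instantiation quat :: real_normed_div_algebra
begin

definition "inverse q = qcnj q /\<^sub>R (norm q)\<^sup>2"
definition "p div q = p * inverse (q::quat)"

instance
proof
  fix p q :: quat
  show "q \<noteq> 0 \<Longrightarrow> inverse q * q = 1"
  proof -
    assume "q \<noteq> 0"
    then have "(norm q)\<^sup>2 \<noteq> 0" by simp
    moreover have "qcnj q * q = of_real ((norm q)\<^sup>2)"
      by (simp add: quat_eq_iff norm_quat_def inner_quat_def)
    moreover have "inverse q * q = (qcnj q * q) /\<^sub>R (norm q)\<^sup>2"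
      by (simp only: inverse_quat_def mult_scaleR_left)
    ultimately show ?thesis
      by (simp only: scaleR_conv_of_real of_real_mult [symmetric] left_inverse of_real_1 not_False_eq_True)
  qed
  show "q \<noteq> 0 \<Longrightarrow> q * inverse q = 1"
  proof -
    assume "q \<noteq> 0"
    then have "(norm q)\<^sup>2 \<noteq> 0" by simp
    moreover have "q * inverse q = (q * qcnj q) /\<^sub>R (norm q)\<^sup>2"
      by (simp only: inverse_quat_def mult_scaleR_right)
    ultimately show ?thesis
      by (simp only: mult_qcnj scaleR_conv_of_real of_real_mult [symmetric] left_inverse
          of_real_1 not_False_eq_True)
  qed
  show "p div q = p * inverse q" by (rule divide_quat_def)
  show "inverse 0 = (0::quat)" by (simp add: inverse_quat_def quat_eq_iff)
  show "norm (p * q) = norm p * norm q"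
    by (simp add: norm_quat_def inner_quat_def flip: real_sqrt_mult)
      (simp add: power2_eq_square algebra_simps)
qed

end

definition imag_sphere :: "quat set" where
  "imag_sphere = {q. q * q = - 1}"

definition slice_plane :: "quat \<Rightarrow> quat set" where
  "slice_plane j = {of_real \<alpha> + j * of_real \<beta> | \<alpha> \<beta>. True}"

definition circularization :: "complex set \<Rightarrow> quat set" where
  "circularization K =
    {of_real \<alpha> + j * of_real \<beta> | \<alpha> \<beta> j. Complex \<alpha> \<beta> \<in> K \<and> j \<in> imag_sphere}"


section \<open>Quaternionic two-sided Banach \<open>C\<^sup>*\<close>-algebras\<close>

text \<open>
  The additive group and the unital ring structure are those of the \<open>ring\<close> record of HOL-Algebra.
\<close>

record 'v cstar_struct = "'v ring" +
  lscale :: "quat \<Rightarrow> 'v \<Rightarrow> 'v"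
  rscale :: "'v \<Rightarrow> quat \<Rightarrow> 'v"
  invol :: "'v \<Rightarrow> 'v"
  cnorm :: "'v \<Rightarrow> real"

text \<open>
  The scalars range over a set \<open>S\<close> of quaternions: all of \<open>\<bbbH>\<close> for two-sided quaternionic algebras,
  the reals or a slice plane for algebras over those subfields.
\<close>

locale banach_cstar = ring V for S :: "quat set" and V :: "('v, 'm) cstar_struct_scheme" (structure) +
  assumes lscale_closed: "\<lbrakk>q \<in> S; u \<in> carrier V\<rbrakk> \<Longrightarrow> lscale V q u \<in> carrier V"
    and rscale_closed: "\<lbrakk>q \<in> S; u \<in> carrier V\<rbrakk> \<Longrightarrow> rscale V u q \<in> carrier V"
    and lscale_add_left: "\<lbrakk>p \<in> S; q \<in> S; u \<in> carrier V\<rbrakk> \<Longrightarrow>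
      lscale V (p + q) u = lscale V p u \<oplus> lscale V q u"
    and lscale_add_right: "\<lbrakk>q \<in> S; u \<in> carrier V; v \<in> carrier V\<rbrakk> \<Longrightarrow>
      lscale V q (u \<oplus> v) = lscale V q u \<oplus> lscale V q v"
    and rscale_add_left: "\<lbrakk>q \<in> S; u \<in> carrier V; v \<in> carrier V\<rbrakk> \<Longrightarrow>
      rscale V (u \<oplus> v) q = rscale V u q \<oplus> rscale V v q"
    and rscale_add_right: "\<lbrakk>p \<in> S; q \<in> S; u \<in> carrier V\<rbrakk> \<Longrightarrow>
      rscale V u (p + q) = rscale V u p \<oplus> rscale V u q"
    and lscale_lscale: "\<lbrakk>p \<in> S; q \<in> S; u \<in> carrier V\<rbrakk> \<Longrightarrow>
      lscale V q (lscale V p u) = lscale V (q * p) u"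
    and rscale_rscale: "\<lbrakk>p \<in> S; q \<in> S; u \<in> carrier V\<rbrakk> \<Longrightarrow>
      rscale V (rscale V u p) q = rscale V u (p * q)"
    and rscale_lscale: "\<lbrakk>p \<in> S; q \<in> S; u \<in> carrier V\<rbrakk> \<Longrightarrow>
      rscale V (lscale V q u) p = lscale V q (rscale V u p)"
    and lscale_one: "u \<in> carrier V \<Longrightarrow> lscale V 1 u = u"
    and rscale_one: "u \<in> carrier V \<Longrightarrow> rscale V u 1 = u"
    and lscale_real: "\<lbrakk>q \<in> S; q \<in> \<real>; u \<in> carrier V\<rbrakk> \<Longrightarrow> lscale V q u = rscale V u q"
    and lscale_mult: "\<lbrakk>q \<in> S; u \<in> carrier V; v \<in> carrier V\<rbrakk> \<Longrightarrow>
      lscale V q (u \<otimes> v) = lscale V q u \<otimes> v"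
    and rscale_mult: "\<lbrakk>q \<in> S; u \<in> carrier V; v \<in> carrier V\<rbrakk> \<Longrightarrow>
      rscale V (u \<otimes> v) q = u \<otimes> rscale V v q"
    and invol_closed: "u \<in> carrier V \<Longrightarrow> invol V u \<in> carrier V"
    and invol_invol: "u \<in> carrier V \<Longrightarrow> invol V (invol V u) = u"
    and invol_add: "\<lbrakk>u \<in> carrier V; v \<in> carrier V\<rbrakk> \<Longrightarrow>
      invol V (u \<oplus> v) = invol V u \<oplus> invol V v"
    and invol_lscale: "\<lbrakk>q \<in> S; u \<in> carrier V\<rbrakk> \<Longrightarrow>
      invol V (lscale V q u) = rscale V (invol V u) (qcnj q)"
    and invol_rscale: "\<lbrakk>q \<in> S; u \<in> carrier V\<rbrakk> \<Longrightarrow>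
      invol V (rscale V u q) = lscale V (qcnj q) (invol V u)"
    and invol_mult: "\<lbrakk>u \<in> carrier V; v \<in> carrier V\<rbrakk> \<Longrightarrow>
      invol V (u \<otimes> v) = invol V v \<otimes> invol V u"
    and cnorm_nonneg: "u \<in> carrier V \<Longrightarrow> 0 \<le> cnorm V u"
    and cnorm_eq_0: "u \<in> carrier V \<Longrightarrow> cnorm V u = 0 \<longleftrightarrow> u = \<zero>"
    and cnorm_add: "\<lbrakk>u \<in> carrier V; v \<in> carrier V\<rbrakk> \<Longrightarrow> cnorm V (u \<oplus> v) \<le> cnorm V u + cnorm V v"
    and cnorm_lscale: "\<lbrakk>q \<in> S; u \<in> carrier V\<rbrakk> \<Longrightarrow> cnorm V (lscale V q u) = norm q * cnorm V u"
    and cnorm_rscale: "\<lbrakk>q \<in> S; u \<in> carrier V\<rbrakk> \<Longrightarrow> cnorm V (rscale V u q) = norm q * cnorm V u"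
    and cnorm_mult: "\<lbrakk>u \<in> carrier V; v \<in> carrier V\<rbrakk> \<Longrightarrow> cnorm V (u \<otimes> v) \<le> cnorm V u * cnorm V v"
    and cnorm_one: "cnorm V \<one> = 1"
    and cnorm_cstar: "u \<in> carrier V \<Longrightarrow> cnorm V (invol V u \<otimes> u) = (cnorm V u)\<^sup>2"
    and cnorm_complete: "\<lbrakk>\<And>n::nat. X n \<in> carrier V;
        \<And>e. e > 0 \<Longrightarrow> \<exists>N. \<forall>m\<ge>N. \<forall>n\<ge>N. cnorm V (X m \<ominus> X n) < e\<rbrakk> \<Longrightarrow>
      \<exists>x\<in>carrier V. (\<lambda>n. cnorm V (X n \<ominus> x)) \<longlonglongrightarrow> 0"

definition quat_cstar_subalgebra :: "'v set \<Rightarrow> ('v, 'm) cstar_struct_scheme \<Rightarrow> bool" where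
  "quat_cstar_subalgebra A V \<longleftrightarrow>
    A \<subseteq> carrier V \<and> \<one>\<^bsub>V\<^esub> \<in> A \<and> banach_cstar UNIV (V\<lparr>carrier := A\<rparr>)"

definition real_cstar_subalgebra :: "'v set \<Rightarrow> ('v, 'm) cstar_struct_scheme \<Rightarrow> bool" where
  "real_cstar_subalgebra A V \<longleftrightarrow>
    A \<subseteq> carrier V \<and> \<one>\<^bsub>V\<^esub> \<in> A \<and> banach_cstar \<real> (V\<lparr>carrier := A\<rparr>)"

definition slice_cstar_subalgebra ::
    "quat \<Rightarrow> 'v set \<Rightarrow> ('v, 'm) cstar_struct_scheme \<Rightarrow> bool" where
  "slice_cstar_subalgebra j A V \<longleftrightarrow>
    A \<subseteq> carrier V \<and> \<one>\<^bsub>V\<^esub> \<in> A \<and> banach_cstar (slice_plane j) (V\<lparr>carrier := A\<rparr>) \<and>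
    (\<forall>q\<in>slice_plane j. \<forall>u\<in>A. lscale V q u = rscale V u q)"

definition mult_commutative :: "'v set \<Rightarrow> ('v, 'm) cstar_struct_scheme \<Rightarrow> bool" where
  "mult_commutative A V \<longleftrightarrow> (\<forall>u\<in>A. \<forall>v\<in>A. u \<otimes>\<^bsub>V\<^esub> v = v \<otimes>\<^bsub>V\<^esub> u)"


section \<open>Continuous slice functions\<close>

text \<open>
  An element \<open>a + i b\<close> of \<open>\<bbbH> \<otimes>\<^sub>\<real> \<complex>\<close> is the pair \<open>(a, b)\<close>. Functions on \<open>K\<close> and on its
  circularization are extensional, so that equality of functions is equality on the domain.
\<close>

definition cq_mult :: "quat \<times> quat \<Rightarrow> quat \<times> quat \<Rightarrow> quat \<times> quat" where
  "cq_mult x y = (fst x * fst y - snd x * snd y, fst x * snd y + snd x * fst y)"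

definition cq_star :: "quat \<times> quat \<Rightarrow> quat \<times> quat" where
  "cq_star x = (qcnj (fst x), - qcnj (snd x))"

definition stem_functions :: "complex set \<Rightarrow> (complex \<Rightarrow> quat \<times> quat) set" where
  "stem_functions K = {F \<in> extensional K.
     continuous_on K (\<lambda>z. fst (F z)) \<and> continuous_on K (\<lambda>z. snd (F z)) \<and>
     (\<forall>z\<in>K. fst (F (cnj z)) = fst (F z) \<and> snd (F (cnj z)) = - snd (F z))}"

definition slice_of :: "complex set \<Rightarrow> (complex \<Rightarrow> quat \<times> quat) \<Rightarrow> quat \<Rightarrow> quat" where
  "slice_of K F = (\<lambda>q\<in>circularization K. THE v.
     \<forall>\<alpha> \<beta> j. Complex \<alpha> \<beta> \<in> K \<and> j \<in> imag_sphere \<and> q = of_real \<alpha> + j * of_real \<beta> \<longrightarrow>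
       v = fst (F (Complex \<alpha> \<beta>)) + j * snd (F (Complex \<alpha> \<beta>)))"

definition slice_functions :: "complex set \<Rightarrow> (quat \<Rightarrow> quat) set" where
  "slice_functions K = slice_of K ` stem_functions K"

definition stem_of :: "complex set \<Rightarrow> (quat \<Rightarrow> quat) \<Rightarrow> complex \<Rightarrow> quat \<times> quat" where
  "stem_of K = inv_into (stem_functions K) (slice_of K)"

definition slice_functions_valued :: "quat set \<Rightarrow> complex set \<Rightarrow> (quat \<Rightarrow> quat) set" where
  "slice_functions_valued A K =
     {f \<in> slice_functions K. \<forall>z\<in>K. fst (stem_of K f z) \<in> A \<and> snd (stem_of K f z) \<in> A}"

definition circular_slice_functions :: "complex set \<Rightarrow> (quat \<Rightarrow> quat) set" where
  "circular_slice_functions K = {f \<in> slice_functions K. \<forall>z\<in>K. snd (stem_of K f z) = 0}"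

definition slice_mult ::
    "complex set \<Rightarrow> (quat \<Rightarrow> quat) \<Rightarrow> (quat \<Rightarrow> quat) \<Rightarrow> quat \<Rightarrow> quat" where
  "slice_mult K f g = slice_of K (\<lambda>z. cq_mult (stem_of K f z) (stem_of K g z))"

definition slice_star :: "complex set \<Rightarrow> (quat \<Rightarrow> quat) \<Rightarrow> quat \<Rightarrow> quat" where
  "slice_star K f = slice_of K (\<lambda>z. cq_star (stem_of K f z))"

definition const_slice :: "complex set \<Rightarrow> quat \<Rightarrow> quat \<Rightarrow> quat" where
  "const_slice K q = (\<lambda>x\<in>circularization K. q)"

definition slice_algebra :: "complex set \<Rightarrow> (quat \<Rightarrow> quat) cstar_struct" where
  "slice_algebra K =
    \<lparr>carrier = slice_functions K,
     monoid.mult = slice_mult K,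
     one = const_slice K 1,
     zero = const_slice K 0,
     add = (\<lambda>f g. \<lambda>x\<in>circularization K. f x + g x),
     lscale = (\<lambda>q f. slice_mult K (const_slice K q) f),
     rscale = (\<lambda>f q. slice_mult K f (const_slice K q)),
     invol = slice_star K,
     cnorm = (\<lambda>f. SUP x\<in>circularization K. norm (f x))\<rparr>"


subsection \<open>Well-definedness of \<open>slice_of\<close> and \<open>stem_of\<close>\<close>

lemma imag_sphere_iff: "j \<in> imag_sphere \<longleftrightarrow> qRe j = 0 \<and> (qI j)\<^sup>2 + (qJ j)\<^sup>2 + (qK j)\<^sup>2 = 1"
proof
  assume "j \<in> imag_sphere"
  then have e: "qRe j * qRe j - qI j * qI j - qJ j * qJ j - qK j * qK j = -1"
    and c: "qRe j * qI j = 0" "qRe j * qJ j = 0" "qRe j * qK j = 0"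
    by (auto simp: imag_sphere_def quat_eq_iff)
  have "qRe j = 0"
  proof (rule ccontr)
    assume "qRe j \<noteq> 0"
    with c have "qI j = 0" "qJ j = 0" "qK j = 0" by auto
    with e have "qRe j * qRe j = -1" by simp
    with zero_le_square[of "qRe j"] show False by linarith
  qed
  with e show "qRe j = 0 \<and> (qI j)\<^sup>2 + (qJ j)\<^sup>2 + (qK j)\<^sup>2 = 1"
    by (simp add: power2_eq_square)
qed (auto simp: imag_sphere_def quat_eq_iff power2_eq_square)

lemma slice_coords_unique:
  assumes "i \<in> imag_sphere" "j \<in> imag_sphere"
    and "of_real a + i * of_real b = of_real c + j * of_real d"
  shows "a = c \<and> (b = 0 \<and> d = 0 \<or> b = d \<and> i = j \<or> b = - d \<and> i = - j)"
proof -
  have eqs: "a = c" "qI i * b = qI j * d" "qJ i * b = qJ j * d" "qK i * b = qK j * d"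
    using assms by (auto simp: quat_eq_iff imag_sphere_iff)
  have "b\<^sup>2 = ((qI i)\<^sup>2 + (qJ i)\<^sup>2 + (qK i)\<^sup>2) * b\<^sup>2"
    using assms by (simp add: imag_sphere_iff)
  also have "\<dots> = (qI i * b)\<^sup>2 + (qJ i * b)\<^sup>2 + (qK i * b)\<^sup>2"
    by (simp add: power_mult_distrib algebra_simps)
  also have "\<dots> = ((qI j)\<^sup>2 + (qJ j)\<^sup>2 + (qK j)\<^sup>2) * d\<^sup>2"
    by (simp only: eqs) (simp add: power_mult_distrib algebra_simps)
  also have "\<dots> = d\<^sup>2" using assms by (simp add: imag_sphere_iff)
  finally have "b = d \<or> b = - d" by (simp add: power2_eq_iff)
  then show ?thesis
  proof
    assume "b = d"
    with eqs assms show ?thesis by (auto simp: quat_eq_iff imag_sphere_iff)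
  next
    assume b: "b = - d"
    have *: "x = - y" if "x * b = y * d" "d \<noteq> 0" for x y :: real
    proof -
      have "(x + y) * d = 0" using that b by (simp add: algebra_simps)
      with that show ?thesis by simp
    qed
    show ?thesis
    proof (cases "d = 0")
      case False
      then have "i = - j"
        using *[OF eqs(2)] *[OF eqs(3)] *[OF eqs(4)] assms by (simp add: quat_eq_iff imag_sphere_iff)
      with b eqs show ?thesis by simp
    qed (use b eqs in simp)
  qed
qed

lemma slice_of_apply:
  assumes par: "\<forall>z\<in>K. fst (F (cnj z)) = fst (F z) \<and> snd (F (cnj z)) = - snd (F z)"
    and K: "Complex \<alpha> \<beta> \<in> K" and j: "j \<in> imag_sphere"
  shows "slice_of K F (of_real \<alpha> + j * of_real \<beta>) =
    fst (F (Complex \<alpha> \<beta>)) + j * snd (F (Complex \<alpha> \<beta>))"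
proof -
  let ?q = "of_real \<alpha> + j * of_real \<beta>"
  have mem: "?q \<in> circularization K"
    using K j by (auto simp: circularization_def)
  have uniq: "fst (F (Complex \<alpha> \<beta>)) + j * snd (F (Complex \<alpha> \<beta>)) =
      fst (F (Complex a b)) + i * snd (F (Complex a b))"
    if "Complex a b \<in> K" "i \<in> imag_sphere" "?q = of_real a + i * of_real b" for a b i
  proof -
    have P: "snd (F (Complex x 0)) = 0" if "Complex x 0 \<in> K" for x
    proof -
      have "snd (F (Complex x 0)) = - snd (F (Complex x 0))"
        using par that by (metis complex_cnj minus_zero)
      then show ?thesis by (simp add: quat_eq_iff)
    qed
    from slice_coords_unique[OF j that(2,3)]
    have ac: "\<alpha> = a" and cs: "\<beta> = 0 \<and> b = 0 \<or> \<beta> = b \<and> j = i \<or> \<beta> = - b \<and> j = - i" by auto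
    from cs show ?thesis
    proof (elim disjE conjE)
      assume "\<beta> = - b" "j = - i"
      moreover have "Complex a (- b) = cnj (Complex a b)" by (simp add: complex_eq_iff)
      ultimately show ?thesis using par that(1) ac by simp
    qed (use ac P that(1) in auto)
  qed
  show ?thesis
    unfolding slice_of_def restrict_apply'[OF mem]
    by (rule the_equality) (use uniq K j in blast)+
qed

lemma slice_of_inj: "inj_on (slice_of K) (stem_functions K)"
proof (rule inj_onI)
  fix F G assume F: "F \<in> stem_functions K" and G: "G \<in> stem_functions K"
    and eq: "slice_of K F = slice_of K G"
  show "F = G"
  proof (rule extensionalityI[of _ K])
    fix z assume z: "z \<in> K"
    let ?j = "Quat 0 1 0 0"
    have S: "?j \<in> imag_sphere" "- ?j \<in> imag_sphere" by (simp_all add: imag_sphere_iff)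
    have zK: "Complex (Re z) (Im z) \<in> K" using z by simp
    have "fst (F z) + i * snd (F z) = fst (G z) + i * snd (G z)" if "i \<in> imag_sphere" for i
      using slice_of_apply[OF _ zK that, of F] slice_of_apply[OF _ zK that, of G] F G eq
      by (simp add: stem_functions_def)
    from this[OF S(1)] this[OF S(2)] show "F z = G z"
      by (simp add: prod_eq_iff quat_eq_iff)
  qed (use F G in \<open>auto simp: stem_functions_def\<close>)
qed

lemma stem_of_slice_of: "F \<in> stem_functions K \<Longrightarrow> stem_of K (slice_of K F) = F"
  by (simp add: stem_of_def slice_of_inj inv_into_f_f)

lemma stem_of_mem: "f \<in> slice_functions K \<Longrightarrow> stem_of K f \<in> stem_functions K"
  by (simp add: stem_of_def slice_functions_def inv_into_into)

lemma slice_of_stem_of: "f \<in> slice_functions K \<Longrightarrow> slice_of K (stem_of K f) = f"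
  by (simp add: stem_of_def slice_functions_def f_inv_into_f)


subsection \<open>Finiteness of the supremum norm\<close>

text \<open>
  The supremum norm takes finite values on all continuous slice functions only if \<open>K\<close> is compact.
\<close>

lemma compact_if_bounded_slice_functions:
  assumes cnjK: "\<And>z. z \<in> K \<Longrightarrow> cnj z \<in> K"
    and bdd: "\<And>f. f \<in> slice_functions K \<Longrightarrow> bdd_above ((\<lambda>x. norm (f x)) ` circularization K)"
  shows "compact K"
proof -
  have real_bdd: "bdd_above (h ` K)"
    if h: "continuous_on K h" "\<And>z. z \<in> K \<Longrightarrow> h (cnj z) = h z" for h :: "complex \<Rightarrow> real"
  proof -
    define F where "F = (\<lambda>z\<in>K. (of_real (h z) :: quat, 0 :: quat))"
    have "continuous_on K (\<lambda>z. fst (F z)) \<longleftrightarrow> continuous_on K (\<lambda>z. of_real (h z) :: quat)"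
      and "continuous_on K (\<lambda>z. snd (F z)) \<longleftrightarrow> continuous_on K (\<lambda>z. 0 :: quat)"
      by (rule continuous_on_cong; simp add: F_def)+
    moreover have "continuous_on K (\<lambda>z. of_real (h z) :: quat)"
      by (intro continuous_intros h)
    ultimately have F: "F \<in> stem_functions K"
      using h cnjK by (auto simp: stem_functions_def F_def)
    then obtain M where M: "\<And>x. x \<in> circularization K \<Longrightarrow> norm (slice_of K F x) \<le> M"
      using bdd[of "slice_of K F"] by (auto simp: slice_functions_def bdd_above_def)
    have "h z \<le> M" if z: "z \<in> K" for z
    proof -
      let ?j = "Quat 0 1 0 0"
      have S: "?j \<in> imag_sphere" by (simp add: imag_sphere_iff)
      have zK: "Complex (Re z) (Im z) \<in> K" using z by simp
      have "slice_of K F (of_real (Re z) + ?j * of_real (Im z)) = of_real (h z)"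
        using slice_of_apply[OF _ zK S, of F] F z by (simp add: stem_functions_def F_def)
      moreover have "of_real (Re z) + ?j * of_real (Im z) \<in> circularization K"
        using S zK unfolding circularization_def by blast
      ultimately show "h z \<le> M" using M by (metis abs_le_D1 norm_of_real)
    qed
    then show ?thesis by (auto simp: bdd_above_def)
  qed
  have "bounded K"
    using real_bdd[of norm] by (auto simp: bounded_iff bdd_above_def intro: continuous_intros)
  moreover have "closed K"
  proof (rule ccontr)
    assume "\<not> closed K"
    then obtain p where p: "p islimpt K" "p \<notin> K" by (auto simp: closed_limpt)
    define h where "h z = inverse (norm (z - p)) + inverse (norm (cnj z - p))" for z
    have ne: "z \<noteq> p" "cnj z \<noteq> p" if "z \<in> K" for z using that p cnjK by auto
    have "continuous_on K h"
      unfolding h_def using ne by (intro continuous_intros) auto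
    then obtain M where M: "\<And>z. z \<in> K \<Longrightarrow> h z \<le> M"
      using real_bdd[of h] by (auto simp: h_def bdd_above_def add.commute)
    define e where "e = inverse (\<bar>M\<bar> + 1)"
    have e: "e > 0" by (simp add: e_def)
    then obtain z where z: "z \<in> K" "z \<noteq> p" "dist z p < e"
      using p(1) unfolding islimpt_approachable by blast
    have "inverse e < inverse (norm (z - p))"
      using z by (intro less_imp_inverse_less) (auto simp: dist_norm)
    then have "\<bar>M\<bar> + 1 < inverse (norm (z - p))" by (simp add: e_def)
    also have "\<dots> \<le> h z" by (simp add: h_def)
    finally show False using M[OF z(1)] by linarith
  qed
  ultimately show ?thesis by (simp add: compact_eq_bounded_closed)
qed

end

theory Submission
  imports Defs
begin

text \<open>
  A slice function is handled through its stem function \<open>F : K \<rightarrow> \<bbbH> \<otimes>\<^sub>\<real> \<complex>\<close>, so that all the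
  algebraic identities become pointwise identities in \<open>\<bbbH> \<otimes>\<^sub>\<real> \<complex>\<close>. The supremum of
  \<open>|a + j b|\<close> over the unit sphere of imaginary units is a \<open>C\<^sup>*\<close>-norm on \<open>\<bbbH> \<otimes>\<^sub>\<real> \<complex>\<close>: its square is
  \<open>|a|\<^sup>2 + |b|\<^sup>2 + 2 |Im (a b\<^sup>c)|\<close>, where \<open>b\<^sup>c\<close> is the conjugate of \<open>b\<close>. The supremum norm of
  a slice function is the supremum over \<open>K\<close> of this norm of its stem function, and it is complete
  because uniform limits of stem functions are stem functions. The same holds for stem functions with
  values in a real subspace that is closed under the product and the involution and contains the
  scalars; the four assertions are the cases \<open>\<bbbH> \<times> \<bbbH>\<close>, \<open>\<real> \<times> \<real>\<close>, \<open>\<complex>\<^sub>j \<times> \<complex>\<^sub>j\<close> and \<open>\<bbbH> \<times> {0}\<close>.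
\<close>

section \<open>The Euclidean space of quaternions\<close>

text \<open>Finite dimension supplies completeness for uniform limits, continuity of linear maps and
  closedness of subspaces.\<close>

instantiation quat :: euclidean_space
begin

definition "Basis = {Quat 1 0 0 0, Quat 0 1 0 0, Quat 0 0 1 0, Quat 0 0 0 1}"

instance
proof
  fix u v x :: quat
  show "(Basis :: quat set) \<noteq> {}" "finite (Basis :: quat set)"
    by (simp_all add: Basis_quat_def)
  show "inner u v = (if u = v then 1 else 0)" if "u \<in> Basis" "v \<in> Basis"
    using that unfolding Basis_quat_def
    by (elim insertE emptyE) (simp_all add: inner_quat_def)
  show "(\<forall>u\<in>Basis. inner x u = 0) \<longleftrightarrow> x = 0"
    unfolding Basis_quat_def by (cases x) (simp add: inner_quat_def zero_quat_def)
qed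

end

section \<open>Vector part and conjugation of quaternions\<close>

definition qvec :: "quat \<Rightarrow> quat" where
  "qvec p = Quat 0 (qI p) (qJ p) (qK p)"

lemma qvec_simps [simp]:
  "qRe (qvec p) = 0" "qI (qvec p) = qI p" "qJ (qvec p) = qJ p" "qK (qvec p) = qK p"
  by (simp_all add: qvec_def)

lemma norm_quat_power2: "(norm q)\<^sup>2 = (qRe q)\<^sup>2 + (qI q)\<^sup>2 + (qJ q)\<^sup>2 + (qK q)\<^sup>2"
  by (simp add: norm_quat_def inner_quat_def power2_eq_square)

lemma norm_qcnj [simp]: "norm (qcnj q) = norm q"
  by (simp add: norm_quat_def inner_quat_def)

lemma norm_qvec_power2: "(norm (qvec p))\<^sup>2 = (norm p)\<^sup>2 - (qRe p)\<^sup>2"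
  by (simp add: norm_quat_power2)

lemma qcnj_linear: "linear qcnj"
  by (intro linearI) (simp_all add: quat_eq_iff)

lemma continuous_on_qcnj: "continuous_on A f \<Longrightarrow> continuous_on A (\<lambda>x. qcnj (f x))"
  by (rule bounded_linear.continuous_on[OF linear_conv_bounded_linear[THEN iffD1, OF qcnj_linear]])

lemma qcnj_add: "qcnj (p + q) = qcnj p + qcnj q"
  by (simp add: quat_eq_iff)

lemma qcnj_minus: "qcnj (- p) = - qcnj p"
  by (simp add: quat_eq_iff)

lemma qcnj_diff: "qcnj (p - q) = qcnj p - qcnj q"
  by (simp add: quat_eq_iff)

lemma qcnj_mult: "qcnj (p * q) = qcnj q * qcnj p"
  by (simp add: quat_eq_iff algebra_simps)

lemma qcnj_qcnj [simp]: "qcnj (qcnj p) = p"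
  by (simp add: quat_eq_iff)

lemma qcnj_0 [simp]: "qcnj 0 = 0"
  by (simp add: quat_eq_iff)

lemma qcnj_of_real [simp]: "qcnj (of_real r) = of_real r"
  by (simp add: quat_eq_iff)

lemma qcnj_Reals: "p \<in> \<real> \<Longrightarrow> qcnj p \<in> \<real>"
  by (auto elim!: Reals_cases)

lemma quat_Reals_commute: "p \<in> \<real> \<Longrightarrow> p * q = q * (p :: quat)"
  by (auto simp: Reals_def quat_eq_iff)

lemma subspace_Reals: "subspace (\<real> :: 'a::real_algebra_1 set)"
  by (auto simp: subspace_def scaleR_conv_of_real)

section \<open>Imaginary units and slice planes\<close>

lemma norm_imag_sphere: "j \<in> imag_sphere \<Longrightarrow> norm j = 1"
  by (simp add: imag_sphere_iff norm_quat_def inner_quat_def power2_eq_square)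

lemma imag_sphere_nonempty: "imag_sphere \<noteq> {}"
proof -
  have "Quat 0 1 0 0 \<in> imag_sphere"
    by (simp add: imag_sphere_iff)
  then show ?thesis by blast
qed

text \<open>Conjugation by \<open>v\<close> is multiplicative and fixes -1, so it preserves the
  square roots of -1.\<close>

lemma imag_sphere_conj:
  assumes "j \<in> imag_sphere" "v \<noteq> 0"
  shows "inverse v * j * v \<in> imag_sphere"
proof -
  have "inverse v * j * v * (inverse v * j * v) = inverse v * (j * (v * inverse v) * j) * v"
    by (simp only: mult.assoc)
  also have "\<dots> = inverse v * (j * j) * v"
    using assms by simp
  also have "\<dots> = - 1"
    using assms by (simp add: imag_sphere_def)
  finally show ?thesis by (simp add: imag_sphere_def)
qed

lemma slice_plane_subspace: "subspace (slice_plane j)"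
proof -
  have "of_real a + j * of_real b = a *\<^sub>R 1 + b *\<^sub>R j" for a b
    by (simp add: quat_eq_iff)
  then have "slice_plane j = range (\<lambda>(a, b). a *\<^sub>R 1 + b *\<^sub>R j)"
    by (auto simp: slice_plane_def)
  also have "subspace \<dots>"
    by (intro linear_subspace_image subspace_UNIV linearI)
      (auto simp: scaleR_add_left scaleR_add_right)
  finally show ?thesis .
qed

lemma slice_plane_of_real: "of_real a \<in> slice_plane j"
  unfolding slice_plane_def by (rule CollectI, rule exI[of _ a], rule exI[of _ 0]) simp

text \<open>As \<open>j * j = - 1\<close>, products follow the rule for complex numbers, which is
  symmetric in the two factors.\<close>

lemma slice_plane_mult:
  assumes j: "j \<in> imag_sphere" and "p \<in> slice_plane j" "q \<in> slice_plane j"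
  shows "p * q \<in> slice_plane j" "p * q = q * p"
proof -
  obtain a b c d where pq: "p = of_real a + j * of_real b" "q = of_real c + j * of_real d"
    using assms by (auto simp: slice_plane_def)
  have jj: "j * j = - 1" using j by (simp add: imag_sphere_def)
  have "j * of_real b * (j * of_real d) = j * j * of_real (b * d)" for b d
    by (simp add: quat_eq_iff algebra_simps)
  with jj have *: "j * of_real b * (j * of_real d) = - of_real (b * d)" for b d
    by simp
  have "(of_real a + j * of_real b) * (of_real c + j * of_real d) =
      of_real (a * c - b * d) + j * of_real (a * d + b * c)" for a b c d
    unfolding distrib_left distrib_right * by (simp add: quat_eq_iff algebra_simps)
  then show "p * q \<in> slice_plane j" "p * q = q * p"
    unfolding pq slice_plane_def by (blast, simp only: mult.commute add.commute)
qed

lemma slice_plane_qcnj: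
  assumes j: "j \<in> imag_sphere" and "p \<in> slice_plane j"
  shows "qcnj p \<in> slice_plane j"
proof -
  obtain a b where p: "p = of_real a + j * of_real b"
    using assms by (auto simp: slice_plane_def)
  have "qcnj p = of_real a + j * of_real (- b)"
    using j by (simp add: p quat_eq_iff imag_sphere_iff)
  then show ?thesis unfolding slice_plane_def by blast
qed

section \<open>The \<open>C\<^sup>*\<close>-norm on the complexified quaternions\<close>

text \<open>If \<open>x\<close> is the value of a stem function at \<alpha> + i \<beta>, this is the
  supremum of the modulus of the slice function on the sphere of all \<alpha> + j \<beta>.\<close>

definition cq_norm :: "quat \<times> quat \<Rightarrow> real" where
  "cq_norm x = (SUP j\<in>imag_sphere. norm (fst x + j * snd x))"

lemma norm_slice_le:
  assumes "j \<in> imag_sphere"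
  shows "norm (a + j * b) \<le> norm a + norm b"
  using norm_triangle_ineq[of a "j * b"] norm_imag_sphere[OF assms] by (simp add: norm_mult)

lemma cq_norm_upper: "j \<in> imag_sphere \<Longrightarrow> norm (fst x + j * snd x) \<le> cq_norm x"
  unfolding cq_norm_def
  by (rule cSUP_upper) (auto intro!: bdd_aboveI2 norm_slice_le)

lemma cq_norm_least: "(\<And>j. j \<in> imag_sphere \<Longrightarrow> norm (fst x + j * snd x) \<le> c) \<Longrightarrow> cq_norm x \<le> c"
  unfolding cq_norm_def by (rule cSUP_least) (auto simp: imag_sphere_nonempty)

lemma cq_norm_nonneg: "0 \<le> cq_norm x"
proof -
  obtain j where "j \<in> imag_sphere" using imag_sphere_nonempty by auto
  then show ?thesis by (rule order_trans[OF norm_ge_zero cq_norm_upper])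
qed

text \<open>The cross term \<open>inner a (j * b)\<close> equals
  \<open>inner j (a * qcnj b)\<close>, and \<open>j\<close> has no real part. Thus \<open>j\<close>
  enters only through a linear functional.\<close>

lemma norm_slice_power2:
  assumes "j \<in> imag_sphere"
  shows "(norm (a + j * b))\<^sup>2 = (norm a)\<^sup>2 + (norm b)\<^sup>2 + 2 * inner j (qvec (a * qcnj b))"
proof -
  have "(norm (a + j * b))\<^sup>2 = (norm a)\<^sup>2 + (norm (j * b))\<^sup>2 + 2 * inner a (j * b)"
    by (simp add: power2_norm_eq_inner inner_add_left inner_add_right inner_commute)
  moreover have "inner a (j * b) = inner j (qvec (a * qcnj b))"
    using assms by (simp add: imag_sphere_iff inner_quat_def algebra_simps)
  ultimately show ?thesis
    using norm_imag_sphere[OF assms] by (simp add: norm_mult)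
qed

text \<open>Cauchy-Schwarz bounds the linear term in \<open>j\<close>, with equality at the unit
  vector along the vector part of \<open>a * qcnj b\<close>.\<close>

lemma cq_norm_power2:
  "(cq_norm (a, b))\<^sup>2 = (norm a)\<^sup>2 + (norm b)\<^sup>2 + 2 * norm (qvec (a * qcnj b))"
    (is "_ = ?r")
proof -
  let ?w = "qvec (a * qcnj b)"
  have r: "0 \<le> ?r" by simp
  have le: "norm (a + j * b) \<le> sqrt ?r" if "j \<in> imag_sphere" for j
    using norm_cauchy_schwarz[of j ?w] norm_imag_sphere[OF that] norm_slice_power2[OF that, of a b]
    by (intro real_le_rsqrt) simp
  have "\<exists>j\<in>imag_sphere. inner j ?w = norm ?w"
  \<comment> \<open>If \<open>?w\<close> vanishes, every imaginary unit attains the value; otherwise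
    \<open>?w\<close> is normalised.\<close>
  proof (cases "?w = 0")
    case True
    then show ?thesis using imag_sphere_nonempty by auto
  next
    case False
    let ?j = "?w /\<^sub>R norm ?w"
    have "norm ?j = 1" using False by simp
    then have "(norm ?j)\<^sup>2 = 1" by simp
    then have "?j \<in> imag_sphere"
      unfolding imag_sphere_iff norm_quat_power2 by simp
    moreover have "inner ?j ?w = norm ?w"
      using False by (simp add: power2_norm_eq_inner[symmetric] power2_eq_square)
    ultimately show ?thesis by blast
  qed
  then obtain j where j: "j \<in> imag_sphere" "inner j ?w = norm ?w" by blast
  have "(norm (a + j * b))\<^sup>2 = ?r"
    using norm_slice_power2[OF j(1), of a b] j(2) by simp
  then have "sqrt ?r = norm (a + j * b)"
    by (metis norm_ge_zero real_sqrt_abs abs_of_nonneg)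
  then have "sqrt ?r \<le> cq_norm (a, b)"
    using cq_norm_upper[OF j(1), of "(a, b)"] by simp
  moreover have "cq_norm (a, b) \<le> sqrt ?r"
    by (rule cq_norm_least) (use le in simp)
  ultimately have "cq_norm (a, b) = sqrt ?r" by simp
  with r show ?thesis by simp
qed

lemma norm_le_cq_norm:
  shows norm_fst_le_cq_norm: "norm (fst x) \<le> cq_norm x"
    and norm_snd_le_cq_norm: "norm (snd x) \<le> cq_norm x"
proof -
  have "(norm (fst x))\<^sup>2 \<le> (cq_norm x)\<^sup>2" "(norm (snd x))\<^sup>2 \<le> (cq_norm x)\<^sup>2"
    using cq_norm_power2[of "fst x" "snd x"] by simp_all
  then show "norm (fst x) \<le> cq_norm x" "norm (snd x) \<le> cq_norm x"
    using cq_norm_nonneg[of x] power2_le_imp_le by blast+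
qed

text \<open>Together with \<open>cq_norm_le_2_norm\<close> this makes \<open>cq_norm\<close>
  equivalent to the product norm, so that boundedness and uniform convergence transfer. The constant
  2 counts the two components.\<close>

lemma norm_le_2_cq_norm: "norm x \<le> 2 * cq_norm x"
  using norm_Pair_le[of "fst x" "snd x"] norm_le_cq_norm[of x] by simp

lemma cq_norm_le_2_norm: "cq_norm x \<le> 2 * norm x"
proof (rule cq_norm_least)
  fix j assume "j \<in> imag_sphere"
  then show "norm (fst x + j * snd x) \<le> 2 * norm x"
    using norm_slice_le[of j "fst x" "snd x"] norm_fst_le[of "fst x" "snd x"]
      norm_snd_le[of "snd x" "fst x"] by simp
qed

lemma cq_norm_eq_0: "cq_norm x = 0 \<longleftrightarrow> x = 0"
proof
  assume "cq_norm x = 0"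
  then show "x = 0" using norm_le_2_cq_norm[of x] by simp
next
  assume "x = 0"
  then show "cq_norm x = 0" using cq_norm_le_2_norm[of x] cq_norm_nonneg[of x] by simp
qed

lemma cq_norm_add: "cq_norm (x + y) \<le> cq_norm x + cq_norm y"
proof (rule cq_norm_least)
  fix j assume j: "j \<in> imag_sphere"
  have eq: "fst (x + y) + j * snd (x + y) = (fst x + j * snd x) + (fst y + j * snd y)"
    by (simp add: algebra_simps)
  show "norm (fst (x + y) + j * snd (x + y)) \<le> cq_norm x + cq_norm y"
    unfolding eq by (intro norm_triangle_mono cq_norm_upper j)
qed

text \<open>
  The value at \<open>\<alpha> + j \<beta>\<close> of a slice product \<open>f \<cdot> g\<close> is \<open>v\<close> times the value of \<open>g\<close> at
  \<open>\<alpha> + (v\<inverse> j v) \<beta>\<close>, where \<open>v\<close> is the value of \<open>f\<close>.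
\<close>

lemma cq_norm_mult: "cq_norm (cq_mult x y) \<le> cq_norm x * cq_norm y"
proof (rule cq_norm_least)
  fix j assume j: "j \<in> imag_sphere"
  define v where "v = fst x + j * snd x"
  have jj: "j * (j * u) = - u" for u
    using j by (simp add: imag_sphere_def flip: mult.assoc)
  have val: "fst (cq_mult x y) + j * snd (cq_mult x y) = v * fst y + j * v * snd y"
    by (simp add: cq_mult_def v_def jj algebra_simps)
  show "norm (fst (cq_mult x y) + j * snd (cq_mult x y)) \<le> cq_norm x * cq_norm y"
  proof (cases "v = 0")
    case True
    then show ?thesis by (simp add: val cq_norm_nonneg)
  next
    case False
    let ?j = "inverse v * j * v"
    have "v * fst y + j * v * snd y = v * (fst y + ?j * snd y)"
      using False by (simp add: distrib_left flip: mult.assoc)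
    moreover have "norm (v * (fst y + ?j * snd y)) \<le> cq_norm x * cq_norm y"
      unfolding norm_mult
      using cq_norm_upper[OF j, of x] cq_norm_upper[OF imag_sphere_conj[OF j False], of y]
      by (intro mult_mono) (auto simp: v_def cq_norm_nonneg)
    ultimately show ?thesis by (simp add: val)
  qed
qed

lemma cq_norm_scalar [simp]: "cq_norm (q, 0) = norm q"
  using imag_sphere_nonempty by (simp add: cq_norm_def)

section \<open>Product, involution and scalars on the complexified quaternions\<close>

lemma cq_mult_assoc: "cq_mult (cq_mult x y) z = cq_mult x (cq_mult y z)"
  by (simp add: cq_mult_def algebra_simps)

lemma cq_mult_add_left: "cq_mult (x + y) z = cq_mult x z + cq_mult y z"
  by (simp add: cq_mult_def algebra_simps)

lemma cq_mult_add_right: "cq_mult x (y + z) = cq_mult x y + cq_mult x z"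
  by (simp add: cq_mult_def algebra_simps)

lemma cq_mult_one [simp]: "cq_mult (1, 0) x = x" "cq_mult x (1, 0) = x"
  by (simp_all add: cq_mult_def)

lemma cq_mult_scalars: "cq_mult (p, 0) (q, 0) = (p * q, 0)"
  by (simp add: cq_mult_def)

lemma cq_mult_scalars_left: "cq_mult (p, 0) (cq_mult (q, 0) x) = cq_mult (p * q, 0) x"
  by (simp add: cq_mult_scalars flip: cq_mult_assoc)

lemma cq_mult_scalar_add:
  "cq_mult (p + q, 0) x = cq_mult (p, 0) x + cq_mult (q, 0) x"
  "cq_mult x (p + q, 0) = cq_mult x (p, 0) + cq_mult x (q, 0)"
  by (simp_all add: cq_mult_def algebra_simps)

lemma cq_mult_real: "q \<in> \<real> \<Longrightarrow> cq_mult (q, 0) x = cq_mult x (q, 0)"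
  by (auto simp: cq_mult_def intro: quat_Reals_commute)

lemma cq_star_star [simp]: "cq_star (cq_star x) = x"
  by (simp add: cq_star_def qcnj_minus)

lemma cq_star_add: "cq_star (x + y) = cq_star x + cq_star y"
  by (simp add: cq_star_def qcnj_add)

lemma cq_star_mult: "cq_star (cq_mult x y) = cq_mult (cq_star y) (cq_star x)"
  by (simp add: cq_star_def cq_mult_def qcnj_add qcnj_diff qcnj_mult)

lemma cq_star_scalar [simp]: "cq_star (q, 0) = (qcnj q, 0)"
  by (simp add: cq_star_def)

text \<open>Submultiplicativity gives one inequality; undoing the scaling with
  \<open>inverse q\<close> gives the other.\<close>

lemma cq_norm_lscale: "cq_norm (cq_mult (q, 0) x) = norm q * cq_norm x"
proof (cases "q = 0")
  case True
  then show ?thesis by (simp add: cq_mult_def cq_norm_eq_0 zero_prod_def)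
next
  case False
  have "cq_norm x = cq_norm (cq_mult (inverse q, 0) (cq_mult (q, 0) x))"
    using False by (simp add: cq_mult_scalars flip: cq_mult_assoc)
  also have "\<dots> \<le> inverse (norm q) * cq_norm (cq_mult (q, 0) x)"
    using cq_norm_mult[of "(inverse q, 0)" "cq_mult (q, 0) x"] by (simp add: norm_inverse)
  finally have "norm q * cq_norm x \<le> cq_norm (cq_mult (q, 0) x)"
    using False by (simp add: field_simps)
  then show ?thesis using cq_norm_mult[of "(q, 0)" x] by simp
qed

lemma cq_norm_rscale: "cq_norm (cq_mult x (q, 0)) = norm q * cq_norm x"
proof (cases "q = 0")
  case True
  then show ?thesis by (simp add: cq_mult_def cq_norm_eq_0 zero_prod_def)
next
  case False
  have "cq_norm x = cq_norm (cq_mult (cq_mult x (q, 0)) (inverse q, 0))"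
    using False by (simp add: cq_mult_scalars cq_mult_assoc)
  also have "\<dots> \<le> inverse (norm q) * cq_norm (cq_mult x (q, 0))"
    using cq_norm_mult[of "cq_mult x (q, 0)" "(inverse q, 0)"] by (simp add: norm_inverse mult.commute)
  finally have "norm q * cq_norm x \<le> cq_norm (cq_mult x (q, 0))"
    using False by (simp add: field_simps)
  then show ?thesis using cq_norm_mult[of x "(q, 0)"] by (simp add: mult.commute)
qed

text \<open>
  For \<open>x = (a, b)\<close>, the first component of \<open>x\<^sup>* x\<close> is the real number \<open>s = |a|\<^sup>2 + |b|\<^sup>2\<close>
  and the second one is twice the vector part of \<open>qcnj a * b\<close>, which is as long as that of
  \<open>a * qcnj b\<close>.
\<close>

lemma cq_norm_cstar: "cq_norm (cq_mult (cq_star x) x) = (cq_norm x)\<^sup>2"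
proof -
  obtain a b where x: "x = (a, b)" by force
  define s where "s = (norm a)\<^sup>2 + (norm b)\<^sup>2"
  define w where "w = qcnj a * b - qcnj b * a"
  have s: "0 \<le> s" by (simp add: s_def)
  have s_comp: "s = (qRe a)\<^sup>2 + (qI a)\<^sup>2 + (qJ a)\<^sup>2 + (qK a)\<^sup>2 +
      ((qRe b)\<^sup>2 + (qI b)\<^sup>2 + (qJ b)\<^sup>2 + (qK b)\<^sup>2)"
    by (simp add: s_def norm_quat_power2)
  have m: "cq_mult (cq_star x) x = (of_real s, w)"
    by (simp add: x cq_mult_def cq_star_def w_def quat_eq_iff s_comp power2_eq_square algebra_simps)
  have "w = 2 *\<^sub>R qvec (qcnj a * b)"
    by (simp add: w_def quat_eq_iff algebra_simps)
  \<comment> \<open>\<open>qcnj a * b\<close> and \<open>a * qcnj b\<close> have the same norm and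
    the same real part, hence vector parts of equal length.\<close>
  moreover have "(norm (qvec (qcnj a * b)))\<^sup>2 = (norm (qvec (a * qcnj b)))\<^sup>2"
    unfolding norm_qvec_power2 by (simp add: norm_mult)
  ultimately have nw: "norm w = 2 * norm (qvec (a * qcnj b))" by simp
  \<comment> \<open>Since \<open>w\<close> has no real part, the last term of
    \<open>cq_norm_power2\<close> is \<open>2 * s * norm w\<close>, which completes a
    square.\<close>
  have "qvec (of_real s * qcnj w) = - s *\<^sub>R w"
    by (simp add: quat_eq_iff w_def algebra_simps)
  then have "(cq_norm (of_real s, w))\<^sup>2 = (s + norm w)\<^sup>2"
    using s by (simp add: cq_norm_power2 power2_sum)
  then have "cq_norm (of_real s, w) = s + norm w"
    using s by (auto simp: cq_norm_nonneg)
  then show ?thesis unfolding m nw by (simp add: x cq_norm_power2 s_def)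
qed

section \<open>Slice functions through their stem functions\<close>

text \<open>Joining the two continuity conditions lets limits be taken directly in the product
  space.\<close>

lemma stem_functions_iff:
  "F \<in> stem_functions K \<longleftrightarrow> F \<in> extensional K \<and> continuous_on K F \<and>
     (\<forall>z\<in>K. fst (F (cnj z)) = fst (F z) \<and> snd (F (cnj z)) = - snd (F z))"
proof -
  have "continuous_on K F \<longleftrightarrow> continuous_on K (\<lambda>z. fst (F z)) \<and> continuous_on K (\<lambda>z. snd (F z))"
    using continuous_on_Pair[of K "\<lambda>z. fst (F z)" "\<lambda>z. snd (F z)"]
    by (auto intro: continuous_on_fst continuous_on_snd)
  then show ?thesis by (auto simp: stem_functions_def)
qed

lemma stem_functions_restrict:
  assumes "\<And>z. z \<in> K \<Longrightarrow> cnj z \<in> K" "continuous_on K F"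
    "\<And>z. z \<in> K \<Longrightarrow> fst (F (cnj z)) = fst (F z) \<and> snd (F (cnj z)) = - snd (F z)"
  shows "restrict F K \<in> stem_functions K"
proof -
  have "continuous_on K (restrict F K) \<longleftrightarrow> continuous_on K F"
    by (rule continuous_on_cong) auto
  with assms show ?thesis by (simp add: stem_functions_iff)
qed

lemma slice_of_cong:
  assumes "\<And>z. z \<in> K \<Longrightarrow> F z = G z"
  shows "slice_of K F = slice_of K G"
proof -
  have "(\<forall>\<alpha> \<beta> j. Complex \<alpha> \<beta> \<in> K \<and> j \<in> imag_sphere \<and> q = of_real \<alpha> + j * of_real \<beta> \<longrightarrow>
       v = fst (F (Complex \<alpha> \<beta>)) + j * snd (F (Complex \<alpha> \<beta>))) \<longleftrightarrow>
     (\<forall>\<alpha> \<beta> j. Complex \<alpha> \<beta> \<in> K \<and> j \<in> imag_sphere \<and> q = of_real \<alpha> + j * of_real \<beta> \<longrightarrow>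
       v = fst (G (Complex \<alpha> \<beta>)) + j * snd (G (Complex \<alpha> \<beta>)))" for q v
    using assms by metis
  then show ?thesis by (simp add: slice_of_def)
qed

text \<open>\<open>slice_mult\<close> and \<open>slice_star\<close> apply \<open>slice_of\<close> to
  functions that are not cut off outside \<open>K\<close>; restriction turns these into stem
  functions.\<close>

lemma slice_of_restrict: "slice_of K (restrict F K) = slice_of K F"
  by (rule slice_of_cong) simp

lemma slice_of_extensional: "slice_of K F \<in> extensional (circularization K)"
  by (simp add: slice_of_def)

lemma slice_of_stem_apply:
  assumes "F \<in> stem_functions K" "Complex \<alpha> \<beta> \<in> K" "j \<in> imag_sphere"
  shows "slice_of K F (of_real \<alpha> + j * of_real \<beta>) =
    fst (F (Complex \<alpha> \<beta>)) + j * snd (F (Complex \<alpha> \<beta>))"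
  by (rule slice_of_apply) (use assms in \<open>auto simp: stem_functions_def\<close>)

lemma circularization_cases:
  assumes "q \<in> circularization K"
  obtains \<alpha> \<beta> j where "Complex \<alpha> \<beta> \<in> K" "j \<in> imag_sphere" "q = of_real \<alpha> + j * of_real \<beta>"
  using assms by (auto simp: circularization_def)

lemma slice_of_eqI:
  assumes "F \<in> stem_functions K" "f \<in> extensional (circularization K)"
    "\<And>\<alpha> \<beta> j. Complex \<alpha> \<beta> \<in> K \<Longrightarrow> j \<in> imag_sphere \<Longrightarrow>
      f (of_real \<alpha> + j * of_real \<beta>) = fst (F (Complex \<alpha> \<beta>)) + j * snd (F (Complex \<alpha> \<beta>))"
  shows "f = slice_of K F"
proof (rule extensionalityI[OF assms(2) slice_of_extensional])
  fix q assume "q \<in> circularization K"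
  then show "f q = slice_of K F q"
    by (rule circularization_cases) (simp add: assms slice_of_stem_apply)
qed

text \<open>Compactness keeps the supremum norms finite, as
  \<open>compact_if_bounded_slice_functions\<close> demands; a point of \<open>K\<close> makes the
  suprema range over non-empty sets.\<close>

locale symmetric_compact =
  fixes K :: "complex set"
  assumes nonempty: "K \<noteq> {}" and cnj_closed: "z \<in> K \<Longrightarrow> cnj z \<in> K" and cpt: "compact K"
begin

abbreviation "V \<equiv> slice_algebra K"

definition stem_norm :: "(complex \<Rightarrow> quat \<times> quat) \<Rightarrow> real" where
  "stem_norm F = (SUP z\<in>K. cq_norm (F z))"

lemma stem_restrict:
  assumes "continuous_on K F"
    "\<And>z. z \<in> K \<Longrightarrow> fst (F (cnj z)) = fst (F z) \<and> snd (F (cnj z)) = - snd (F z)"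
  shows "restrict F K \<in> stem_functions K"
  using stem_functions_restrict[OF cnj_closed] assms by blast

lemma stem_const: "(\<lambda>z\<in>K. (q, 0)) \<in> stem_functions K"
  by (rule stem_restrict) auto

lemma stem_add:
  assumes "F \<in> stem_functions K" "G \<in> stem_functions K"
  shows "(\<lambda>z\<in>K. F z + G z) \<in> stem_functions K"
  using assms by (intro stem_restrict continuous_intros) (auto simp: stem_functions_iff)

lemma stem_minus:
  assumes "F \<in> stem_functions K"
  shows "(\<lambda>z\<in>K. - F z) \<in> stem_functions K"
  using assms by (intro stem_restrict continuous_intros) (auto simp: stem_functions_iff)

lemma stem_mult:
  assumes "F \<in> stem_functions K" "G \<in> stem_functions K"
  shows "(\<lambda>z\<in>K. cq_mult (F z) (G z)) \<in> stem_functions K"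
  using assms unfolding cq_mult_def
  by (intro stem_restrict continuous_intros) (auto simp: stem_functions_iff)

lemma stem_star:
  assumes "F \<in> stem_functions K"
  shows "(\<lambda>z\<in>K. cq_star (F z)) \<in> stem_functions K"
  using assms unfolding cq_star_def
  by (intro stem_restrict continuous_on_Pair continuous_on_minus continuous_on_qcnj)
    (simp_all add: stem_functions_def qcnj_minus)

lemma const_slice_eq: "const_slice K q = slice_of K (\<lambda>z\<in>K. (q, 0))"
  by (rule slice_of_eqI[OF stem_const]) (auto simp: const_slice_def circularization_def)

lemma slice_mult_eq:
  assumes "F \<in> stem_functions K" "G \<in> stem_functions K"
  shows "slice_mult K (slice_of K F) (slice_of K G) = slice_of K (\<lambda>z\<in>K. cq_mult (F z) (G z))"
  using assms by (simp add: slice_mult_def stem_of_slice_of slice_of_restrict)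

lemma slice_add_eq:
  assumes "F \<in> stem_functions K" "G \<in> stem_functions K"
  shows "(\<lambda>x\<in>circularization K. slice_of K F x + slice_of K G x) = slice_of K (\<lambda>z\<in>K. F z + G z)"
proof (rule slice_of_eqI[OF stem_add[OF assms]])
  fix \<alpha> \<beta> j assume *: "Complex \<alpha> \<beta> \<in> K" "j \<in> imag_sphere"
  then have "of_real \<alpha> + j * of_real \<beta> \<in> circularization K"
    by (auto simp: circularization_def)
  with * show "(\<lambda>x\<in>circularization K. slice_of K F x + slice_of K G x) (of_real \<alpha> + j * of_real \<beta>) =
      fst ((\<lambda>z\<in>K. F z + G z) (Complex \<alpha> \<beta>)) + j * snd ((\<lambda>z\<in>K. F z + G z) (Complex \<alpha> \<beta>))"
    using assms by (simp add: slice_of_stem_apply algebra_simps)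
qed simp

lemma slice_star_eq:
  assumes "F \<in> stem_functions K"
  shows "slice_star K (slice_of K F) = slice_of K (\<lambda>z\<in>K. cq_star (F z))"
  using assms by (simp add: slice_star_def stem_of_slice_of slice_of_restrict)

section \<open>The supremum norm on stem functions\<close>

lemma bdd_above_stem:
  assumes "F \<in> stem_functions K"
  shows "bdd_above ((\<lambda>z. cq_norm (F z)) ` K)"
proof -
  \<comment> \<open>Compactness of \<open>K\<close> enters here: its continuous image is
    bounded.\<close>
  have "compact (F ` K)"
    using assms cpt by (auto simp: stem_functions_iff intro: compact_continuous_image)
  then obtain M where M: "\<forall>x\<in>F ` K. norm x \<le> M"
    using compact_imp_bounded[THEN bounded_iff[THEN iffD1]] by blast
  have "cq_norm (F z) \<le> 2 * M" if "z \<in> K" for z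
  proof -
    have "norm (F z) \<le> M" using M that by simp
    then show ?thesis using cq_norm_le_2_norm[of "F z"] by linarith
  qed
  then show ?thesis by (rule bdd_aboveI2)
qed

lemma stem_norm_upper: "F \<in> stem_functions K \<Longrightarrow> z \<in> K \<Longrightarrow> cq_norm (F z) \<le> stem_norm F"
  unfolding stem_norm_def by (rule cSUP_upper) (auto intro: bdd_above_stem)

lemma stem_norm_least: "(\<And>z. z \<in> K \<Longrightarrow> cq_norm (F z) \<le> c) \<Longrightarrow> stem_norm F \<le> c"
  unfolding stem_norm_def using nonempty by (rule cSUP_least)

lemma stem_norm_nonneg:
  assumes "F \<in> stem_functions K"
  shows "0 \<le> stem_norm F"
proof -
  obtain z where "z \<in> K" using nonempty by auto
  then show ?thesis by (rule order_trans[OF cq_norm_nonneg stem_norm_upper[OF assms]])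
qed

text \<open>The domain is a union of spheres indexed by \<open>K\<close>, so the supremum is taken
  first over each sphere and then over \<open>K\<close>.\<close>

lemma slice_sup_norm_eq:
  assumes F: "F \<in> stem_functions K"
  shows "(SUP x\<in>circularization K. norm (slice_of K F x)) = stem_norm F"
proof (rule antisym)
  have le: "norm (slice_of K F x) \<le> stem_norm F" if "x \<in> circularization K" for x
    using that
  proof (rule circularization_cases)
    fix \<alpha> \<beta> j assume *: "Complex \<alpha> \<beta> \<in> K" "j \<in> imag_sphere" "x = of_real \<alpha> + j * of_real \<beta>"
    then have "norm (slice_of K F x) \<le> cq_norm (F (Complex \<alpha> \<beta>))"
      by (simp add: slice_of_stem_apply F cq_norm_upper)
    also have "\<dots> \<le> stem_norm F" by (rule stem_norm_upper[OF F *(1)])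
    finally show ?thesis .
  qed
  have bdd: "bdd_above ((\<lambda>x. norm (slice_of K F x)) ` circularization K)"
    by (rule bdd_aboveI2[OF le])
  have mem: "of_real (Re z) + j * of_real (Im z) \<in> circularization K"
    if "z \<in> K" "j \<in> imag_sphere" for z j
    using that unfolding circularization_def by (metis (mono_tags, lifting) complex_surj mem_Collect_eq)
  show "(SUP x\<in>circularization K. norm (slice_of K F x)) \<le> stem_norm F"
    using nonempty imag_sphere_nonempty mem by (intro cSUP_least le) auto
  show "stem_norm F \<le> (SUP x\<in>circularization K. norm (slice_of K F x))"
  proof (intro stem_norm_least cq_norm_least)
    fix z j assume z: "z \<in> K" and j: "j \<in> imag_sphere"
    have "slice_of K F (of_real (Re z) + j * of_real (Im z)) = fst (F z) + j * snd (F z)"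
      using slice_of_stem_apply[OF F _ j, of "Re z" "Im z"] z by simp
    then show "norm (fst (F z) + j * snd (F z)) \<le> (SUP x\<in>circularization K. norm (slice_of K F x))"
      using cSUP_upper[OF mem[OF z j], of "\<lambda>x. norm (slice_of K F x)"] bdd by simp
  qed
qed

lemma stem_norm_scale:
  assumes F: "F \<in> stem_functions K" and G: "G \<in> stem_functions K" and c: "0 \<le> c"
    and eq: "\<And>z. z \<in> K \<Longrightarrow> cq_norm (G z) = c * cq_norm (F z)"
  shows "stem_norm G = c * stem_norm F"
proof (rule antisym)
  show "stem_norm G \<le> c * stem_norm F"
    using eq stem_norm_upper[OF F] c by (intro stem_norm_least) (simp add: mult_left_mono)
  show "c * stem_norm F \<le> stem_norm G"
  \<comment> \<open>For positive \<open>c\<close> the bound on \<open>G\<close> is divided by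
    \<open>c\<close>.\<close>
  proof (cases "c = 0")
    case True
    then show ?thesis using stem_norm_nonneg[OF G] by simp
  next
    case False
    with c have "0 < c" by simp
    then have "stem_norm F \<le> stem_norm G / c"
      using eq stem_norm_upper[OF G] by (intro stem_norm_least) (simp add: field_simps)
    with \<open>0 < c\<close> show ?thesis by (simp add: field_simps)
  qed
qed

lemma stem_norm_eq_0:
  assumes F: "F \<in> stem_functions K"
  shows "stem_norm F = 0 \<longleftrightarrow> (\<forall>z\<in>K. F z = 0)"
proof
  assume *: "stem_norm F = 0"
  show "\<forall>z\<in>K. F z = 0"
  proof
    fix z assume "z \<in> K"
    then show "F z = 0"
      using stem_norm_upper[OF F, of z] * cq_norm_nonneg[of "F z"] cq_norm_eq_0[of "F z"] by simp
  qed
next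
  assume "\<forall>z\<in>K. F z = 0"
  then have "stem_norm F \<le> 0"
    using cq_norm_eq_0[of 0] by (intro stem_norm_least) simp
  with stem_norm_nonneg[OF F] show "stem_norm F = 0" by simp
qed

text \<open>The identity holds pointwise by \<open>cq_norm_cstar\<close>, and squaring is monotone
  on nonnegative reals, so it commutes with the supremum.\<close>

lemma stem_norm_cstar:
  assumes F: "F \<in> stem_functions K"
  shows "stem_norm (\<lambda>z\<in>K. cq_mult (cq_star (F z)) (F z)) = (stem_norm F)\<^sup>2"
proof (rule antisym)
  let ?G = "\<lambda>z\<in>K. cq_mult (cq_star (F z)) (F z)"
  \<comment> \<open>The inner restriction exhibits the left factor as a stem function; it is then
    simplified away.\<close>
  have "(\<lambda>z\<in>K. cq_mult ((\<lambda>z\<in>K. cq_star (F z)) z) (F z)) \<in> stem_functions K"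
    by (intro stem_mult stem_star F)
  then have G: "?G \<in> stem_functions K"
    by (simp cong: restrict_cong)
  show "stem_norm ?G \<le> (stem_norm F)\<^sup>2"
    using stem_norm_upper[OF F]
    by (intro stem_norm_least) (simp add: cq_norm_cstar cq_norm_nonneg power_mono)
  have "stem_norm F \<le> sqrt (stem_norm ?G)"
    using stem_norm_upper[OF G] by (intro stem_norm_least real_le_rsqrt) (simp add: cq_norm_cstar)
  then show "(stem_norm F)\<^sup>2 \<le> stem_norm ?G"
    using stem_norm_nonneg[OF F] stem_norm_nonneg[OF G] power_mono[of _ "sqrt (stem_norm ?G)" 2] by simp
qed

text \<open>A Cauchy sequence in this norm is uniformly Cauchy. Continuity, parity and values in the
  closed set \<open>T\<close> all survive the uniform limit.\<close>

lemma stem_complete: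
  assumes X: "\<And>n. X n \<in> stem_functions K" and T: "closed T" "\<And>n z. z \<in> K \<Longrightarrow> X n z \<in> T"
    and C: "\<And>e. e > 0 \<Longrightarrow> \<exists>N. \<forall>m\<ge>N. \<forall>n\<ge>N. stem_norm (\<lambda>z\<in>K. X m z - X n z) < e"
  shows "\<exists>G\<in>stem_functions K. (\<forall>z\<in>K. G z \<in> T) \<and> (\<lambda>n. stem_norm (\<lambda>z\<in>K. X n z - G z)) \<longlonglongrightarrow> 0"
proof -
  have diff: "(\<lambda>z\<in>K. F z - G z) \<in> stem_functions K"
    if "F \<in> stem_functions K" "G \<in> stem_functions K" for F G
    using stem_add[OF that(1) stem_minus[OF that(2)]] by (simp cong: restrict_cong)
  have "uniformly_Cauchy_on K X"
  proof (rule uniformly_Cauchy_onI)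
    fix e :: real assume e: "e > 0"
    \<comment> \<open>\<open>e / 2\<close> absorbs the factor 2 of
      \<open>norm_le_2_cq_norm\<close>.\<close>
    then obtain N where N: "\<And>m n. m \<ge> N \<Longrightarrow> n \<ge> N \<Longrightarrow> stem_norm (\<lambda>z\<in>K. X m z - X n z) < e / 2"
      using C[of "e / 2"] by auto
    have "dist (X m z) (X n z) < e" if "z \<in> K" "m \<ge> N" "n \<ge> N" for m n z
      using stem_norm_upper[OF diff[OF X X], of z m n] N[of m n] that
        norm_le_2_cq_norm[of "X m z - X n z"] by (simp add: dist_norm)
    then show "\<exists>M. \<forall>z\<in>K. \<forall>m\<ge>M. \<forall>n\<ge>M. dist (X m z) (X n z) < e" by blast
  qed
  then obtain G0 where G0: "uniform_limit K X G0 sequentially"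
    using Cauchy_uniformly_convergent uniformly_convergent_on_def by blast
  \<comment> \<open>The limit is unspecified off \<open>K\<close>; restriction makes it
    extensional.\<close>
  define G where "G = restrict G0 K"
  have lim: "(\<lambda>n. X n z) \<longlonglongrightarrow> G0 z" if "z \<in> K" for z
    using tendsto_uniform_limitI[OF G0 that] .
  have "continuous_on K G0"
    using X by (intro uniform_limit_theorem[OF _ G0]) (auto simp: stem_functions_iff)
  moreover have "fst (G0 (cnj z)) = fst (G0 z) \<and> snd (G0 (cnj z)) = - snd (G0 z)" if z: "z \<in> K" for z
  proof
    \<comment> \<open>Parity of each \<open>X n\<close> turns the sequence at \<open>cnj z\<close>
      into one at \<open>z\<close>; uniqueness of limits then compares the two values of
      \<open>G0\<close>.\<close>
    have "(\<lambda>n. fst (X n z)) \<longlonglongrightarrow> fst (G0 (cnj z))"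
      using tendsto_fst[OF lim[OF cnj_closed[OF z]]] X z by (simp add: stem_functions_iff)
    then show "fst (G0 (cnj z)) = fst (G0 z)"
      using tendsto_fst[OF lim[OF z]] LIMSEQ_unique by blast
    have "(\<lambda>n. - snd (X n z)) \<longlonglongrightarrow> snd (G0 (cnj z))"
      using tendsto_snd[OF lim[OF cnj_closed[OF z]]] X z by (simp add: stem_functions_iff)
    then show "snd (G0 (cnj z)) = - snd (G0 z)"
      using tendsto_minus[OF tendsto_snd[OF lim[OF z]]] LIMSEQ_unique by blast
  qed
  ultimately have G: "G \<in> stem_functions K"
    unfolding G_def by (rule stem_restrict)
  have "G z \<in> T" if "z \<in> K" for z
    using closed_sequentially[OF T(1) T(2)[OF that] lim[OF that]] that by (simp add: G_def)
  moreover have "(\<lambda>n. stem_norm (\<lambda>z\<in>K. X n z - G z)) \<longlonglongrightarrow> 0"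
  proof (rule LIMSEQ_I)
    fix e :: real assume "e > 0"
    \<comment> \<open>\<open>e / 4\<close> doubles to \<open>e / 2\<close> in
      \<open>cq_norm_le_2_norm\<close>, leaving room for the strict bound after the
      supremum.\<close>
    then obtain N where N: "\<And>n z. n \<ge> N \<Longrightarrow> z \<in> K \<Longrightarrow> dist (X n z) (G0 z) < e / 4"
      using uniform_limitD[OF G0, of "e / 4"] unfolding eventually_sequentially by auto
    have "norm (stem_norm (\<lambda>z\<in>K. X n z - G z) - 0) < e" if n: "n \<ge> N" for n
    proof -
      have "cq_norm (X n z - G z) \<le> e / 2" if "z \<in> K" for z
        using cq_norm_le_2_norm[of "X n z - G z"] N[OF n that] that by (simp add: G_def dist_norm)
      then have "stem_norm (\<lambda>z\<in>K. X n z - G z) \<le> e / 2"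
        by (intro stem_norm_least) simp
      with \<open>e > 0\<close> show ?thesis using stem_norm_nonneg[OF diff[OF X G], of n] by simp
    qed
    then show "\<exists>N. \<forall>n\<ge>N. norm (stem_norm (\<lambda>z\<in>K. X n z - G z) - 0) < e" by blast
  qed
  ultimately show ?thesis using G by blast
qed

end

section \<open>Algebras of slice functions with stem functions valued in a subspace\<close>

text \<open>\<open>T\<close> holds the stem values and \<open>S\<close> the scalars. A constant
  slice function \<open>q\<close> has stem value \<open>(q, 0)\<close>, so scalar multiplication is
  an instance of the product.\<close>

locale slice_subalgebra = symmetric_compact +
  fixes T :: "(quat \<times> quat) set" and S :: "quat set"
  assumes subspace: "subspace T"
    and mult_closed: "x \<in> T \<Longrightarrow> y \<in> T \<Longrightarrow> cq_mult x y \<in> T"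
    and star_closed: "x \<in> T \<Longrightarrow> cq_star x \<in> T"
    and one_in: "(1, 0) \<in> T"
    and scalar_in: "q \<in> S \<Longrightarrow> (q, 0) \<in> T"
begin

definition stems :: "(complex \<Rightarrow> quat \<times> quat) set" where
  "stems = {F \<in> stem_functions K. \<forall>z\<in>K. F z \<in> T}"

text \<open>Changing only the carrier of \<open>V\<close> matches the shape of the subalgebra
  definitions.\<close>

definition W :: "(quat \<Rightarrow> quat) cstar_struct" where
  "W = V\<lparr>carrier := {f \<in> slice_functions K. \<forall>z\<in>K. stem_of K f z \<in> T}\<rparr>"

lemma stems_stem: "F \<in> stems \<Longrightarrow> F \<in> stem_functions K"
  by (simp add: stems_def)

lemma restrict_stems: "F \<in> stems \<Longrightarrow> restrict F K = F"
  by (simp add: stems_def stem_functions_def extensional_restrict)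

lemma stems_closed [intro]:
  shows "(q, 0) \<in> T \<Longrightarrow> (\<lambda>z\<in>K. (q, 0)) \<in> stems"
    and "F \<in> stems \<Longrightarrow> G \<in> stems \<Longrightarrow> (\<lambda>z\<in>K. F z + G z) \<in> stems"
    and "F \<in> stems \<Longrightarrow> (\<lambda>z\<in>K. - F z) \<in> stems"
    and "F \<in> stems \<Longrightarrow> G \<in> stems \<Longrightarrow> (\<lambda>z\<in>K. cq_mult (F z) (G z)) \<in> stems"
    and "F \<in> stems \<Longrightarrow> (\<lambda>z\<in>K. cq_star (F z)) \<in> stems"
  by (auto simp: stems_def stem_const stem_add stem_minus stem_mult stem_star mult_closed
      star_closed subspace_add[OF subspace] subspace_neg[OF subspace])

lemma carrier_W: "carrier W = slice_of K ` stems"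
proof -
  have "{f \<in> slice_functions K. \<forall>z\<in>K. stem_of K f z \<in> T} = slice_of K ` stems"
    by (force simp: stems_def slice_functions_def stem_of_slice_of)
  then show ?thesis by (simp add: W_def)
qed

text \<open>The dictionary that rewrites every operation on slice functions as a pointwise operation
  on stem functions.\<close>

lemma W_ops:
  shows "\<one>\<^bsub>W\<^esub> = slice_of K (\<lambda>z\<in>K. (1, 0))"
    and "\<zero>\<^bsub>W\<^esub> = slice_of K (\<lambda>z\<in>K. 0)"
    and "F \<in> stems \<Longrightarrow> G \<in> stems \<Longrightarrow>
      slice_of K F \<otimes>\<^bsub>W\<^esub> slice_of K G = slice_of K (\<lambda>z\<in>K. cq_mult (F z) (G z))"
    and "F \<in> stems \<Longrightarrow> G \<in> stems \<Longrightarrow>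
      slice_of K F \<oplus>\<^bsub>W\<^esub> slice_of K G = slice_of K (\<lambda>z\<in>K. F z + G z)"
    and "F \<in> stems \<Longrightarrow> lscale W q (slice_of K F) = slice_of K (\<lambda>z\<in>K. cq_mult (q, 0) (F z))"
    and "F \<in> stems \<Longrightarrow> rscale W (slice_of K F) q = slice_of K (\<lambda>z\<in>K. cq_mult (F z) (q, 0))"
    and "F \<in> stems \<Longrightarrow> invol W (slice_of K F) = slice_of K (\<lambda>z\<in>K. cq_star (F z))"
    and "F \<in> stems \<Longrightarrow> cnorm W (slice_of K F) = stem_norm F"
  by (simp_all add: W_def slice_algebra_def const_slice_eq slice_mult_eq slice_add_eq slice_star_eq
      slice_sup_norm_eq stems_stem stem_const zero_prod_def cong: restrict_cong)

lemma stems_scale [intro]: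
  assumes "q \<in> S" "F \<in> stems"
  shows "(\<lambda>z\<in>K. cq_mult (q, 0) (F z)) \<in> stems" "(\<lambda>z\<in>K. cq_mult (F z) (q, 0)) \<in> stems"
  using stems_closed(4)[OF stems_closed(1)[OF scalar_in[OF assms(1)]] assms(2)]
    stems_closed(4)[OF assms(2) stems_closed(1)[OF scalar_in[OF assms(1)]]]
  by (simp_all cong: restrict_cong)

lemma stems_0: "(\<lambda>z\<in>K. 0) \<in> stems"
  using stems_closed(1)[of 0] subspace_0[OF subspace] by (simp add: zero_prod_def)

lemmas stems_1 = stems_closed(1)[OF one_in]

lemma slice_of_eq_iff:
  assumes "F \<in> stems" "G \<in> stems"
  shows "slice_of K F = slice_of K G \<longleftrightarrow> (\<forall>z\<in>K. F z = G z)"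
proof
  assume "slice_of K F = slice_of K G"
  then have "F = G"
    using inj_onD[OF slice_of_inj] assms stems_stem by blast
  then show "\<forall>z\<in>K. F z = G z" by simp
qed (rule slice_of_cong, blast)

lemma carrier_WE:
  assumes "f \<in> carrier W"
  obtains F where "F \<in> stems" "f = slice_of K F"
  using assms by (auto simp: carrier_W)

lemma slice_of_in_W: "F \<in> stems \<Longrightarrow> slice_of K F \<in> carrier W"
  by (simp add: carrier_W)

lemmas W_simps = slice_of_in_W W_ops stems_closed stems_0 stems_1 stems_scale restrict_stems

text \<open>Through the dictionary the ring axioms become pointwise identities; only the additive
  inverse needs a witness.\<close>

lemma ring_W: "ring W"
proof (intro ringI abelian_groupI monoidI)
  fix f assume "f \<in> carrier W"
  then obtain F where "F \<in> stems" "f = slice_of K F" by (rule carrier_WE)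
  then show "\<exists>y\<in>carrier W. y \<oplus>\<^bsub>W\<^esub> f = \<zero>\<^bsub>W\<^esub>"
    by (intro bexI[of _ "slice_of K (\<lambda>z\<in>K. - F z)"]) (simp_all add: W_simps cong: restrict_cong)
qed ((elim carrier_WE)?; simp add: W_simps cq_mult_assoc cq_mult_add_left cq_mult_add_right ac_simps
    cong: restrict_cong)+

text \<open>Subtraction in the record is defined through the additive inverse, which is identified
  here by its uniqueness.\<close>

lemma minus_W:
  assumes "F \<in> stems" "G \<in> stems"
  shows "slice_of K F \<ominus>\<^bsub>W\<^esub> slice_of K G = slice_of K (\<lambda>z\<in>K. F z - G z)"
proof -
  interpret ring W by (rule ring_W)
  have "\<ominus>\<^bsub>W\<^esub> slice_of K G = slice_of K (\<lambda>z\<in>K. - G z)"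
    using assms by (intro minus_equality) (simp_all add: W_simps cong: restrict_cong)
  then show ?thesis
    using assms by (simp add: a_minus_def W_simps cong: restrict_cong)
qed

lemma complete_W:
  assumes X: "\<And>n::nat. X n \<in> carrier W"
    and C: "\<And>e. e > 0 \<Longrightarrow> \<exists>N. \<forall>m\<ge>N. \<forall>n\<ge>N. cnorm W (X m \<ominus>\<^bsub>W\<^esub> X n) < e"
  shows "\<exists>x\<in>carrier W. (\<lambda>n. cnorm W (X n \<ominus>\<^bsub>W\<^esub> x)) \<longlonglongrightarrow> 0"
proof -
  obtain F where F: "\<And>n. F n \<in> stems" "\<And>n. X n = slice_of K (F n)"
    using X unfolding carrier_W image_iff by metis
  have norm_diff: "cnorm W (slice_of K G \<ominus>\<^bsub>W\<^esub> slice_of K H) = stem_norm (\<lambda>z\<in>K. G z - H z)"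
    if "G \<in> stems" "H \<in> stems" for G H
  proof -
    have "(\<lambda>z\<in>K. G z - H z) \<in> stems"
      using stems_closed(2)[OF that(1) stems_closed(3)[OF that(2)]] by (simp cong: restrict_cong)
    with that show ?thesis by (simp add: minus_W W_ops)
  qed
  \<comment> \<open>\<open>T\<close> is closed because it is a subspace of a finite-dimensional
    space.\<close>
  have "\<exists>G\<in>stem_functions K. (\<forall>z\<in>K. G z \<in> T) \<and> (\<lambda>n. stem_norm (\<lambda>z\<in>K. F n z - G z)) \<longlonglongrightarrow> 0"
    using F C by (intro stem_complete closed_subspace subspace) (auto simp: stems_def norm_diff)
  then obtain G where "G \<in> stems" "(\<lambda>n. stem_norm (\<lambda>z\<in>K. F n z - G z)) \<longlonglongrightarrow> 0"
    by (auto simp: stems_def)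
  then show ?thesis using F by (auto simp: carrier_W norm_diff)
qed

text \<open>The norm axioms come from estimates on \<open>stem_norm\<close>; the others are
  pointwise identities or \<open>complete_W\<close>.\<close>

lemma banach_cstar_W: "banach_cstar S W"
proof (intro banach_cstar.intro ring_W banach_cstar_axioms.intro)
  fix u v assume uv: "u \<in> carrier W" "v \<in> carrier W"
  then obtain F G where F: "F \<in> stems" "u = slice_of K F" and G: "G \<in> stems" "v = slice_of K G"
    by (auto simp: carrier_W)
  note FG = F(1)[THEN stems_stem] G(1)[THEN stems_stem]
  have le: "stem_norm (\<lambda>z\<in>K. F z + G z) \<le> stem_norm F + stem_norm G"
    using stem_norm_upper[OF FG(1)] stem_norm_upper[OF FG(2)]
    by (intro stem_norm_least) (simp add: order_trans[OF cq_norm_add] add_mono)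
  show "cnorm W (u \<oplus>\<^bsub>W\<^esub> v) \<le> cnorm W u + cnorm W v"
    using le F G by (simp add: W_simps)
  have le: "stem_norm (\<lambda>z\<in>K. cq_mult (F z) (G z)) \<le> stem_norm F * stem_norm G"
    using stem_norm_upper[OF FG(1)] stem_norm_upper[OF FG(2)] stem_norm_nonneg[OF FG(1)]
    by (intro stem_norm_least) (simp add: order_trans[OF cq_norm_mult] mult_mono cq_norm_nonneg)
  show "cnorm W (u \<otimes>\<^bsub>W\<^esub> v) \<le> cnorm W u * cnorm W v"
    using le F G by (simp add: W_simps)
next
  fix u assume "u \<in> carrier W"
  then obtain F where F: "F \<in> stems" "u = slice_of K F"
    by (auto simp: carrier_W)
  note F' = stems_stem[OF F(1)]
  show "0 \<le> cnorm W u" "cnorm W u = 0 \<longleftrightarrow> u = \<zero>\<^bsub>W\<^esub>"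
    using F F' by (simp_all add: W_simps stem_norm_nonneg stem_norm_eq_0 slice_of_eq_iff)
  \<comment> \<open>The stem function of the product of \<open>invol W u\<close> and
    \<open>u\<close>, in the form that the dictionary produces.\<close>
  have "(\<lambda>z\<in>K. cq_mult ((\<lambda>z\<in>K. cq_star (F z)) z) (F z)) \<in> stems"
    using F by blast
  then show "cnorm W (invol W u \<otimes>\<^bsub>W\<^esub> u) = (cnorm W u)\<^sup>2"
    using F F' by (simp add: W_simps stem_norm_cstar cong: restrict_cong)
  fix q assume q: "q \<in> S"
  have "stem_norm (\<lambda>z\<in>K. cq_mult (q, 0) (F z)) = norm q * stem_norm F"
    "stem_norm (\<lambda>z\<in>K. cq_mult (F z) (q, 0)) = norm q * stem_norm F"
    using F' stems_stem[OF stems_scale(1)[OF q F(1)]] stems_stem[OF stems_scale(2)[OF q F(1)]]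
    by (intro stem_norm_scale; simp add: cq_norm_lscale cq_norm_rscale)+
  then show "cnorm W (lscale W q u) = norm q * cnorm W u" "cnorm W (rscale W u q) = norm q * cnorm W u"
    using F q by (simp_all add: W_simps)
next
  have "stem_norm (\<lambda>z\<in>K. (1, 0)) = 1"
    using nonempty by (simp add: stem_norm_def cong: SUP_cong)
  then show "cnorm W \<one>\<^bsub>W\<^esub> = 1" by (simp add: W_simps)
qed ((rule complete_W; blast) | (elim carrier_WE)?;
    simp add: W_simps cq_mult_assoc cq_mult_add_left cq_mult_add_right cq_mult_scalars
      cq_mult_scalars_left cq_mult_scalar_add cq_mult_real cq_star_add cq_star_mult
      cong: restrict_cong)+

end

section \<open>The four algebras as instances of one construction\<close>

theorem theorem6p14:
  fixes K :: "complex set"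
  assumes "K \<noteq> {}" and "\<And>z. z \<in> K \<Longrightarrow> cnj z \<in> K" and "compact K"
  shows "banach_cstar UNIV (slice_algebra K) \<and>
    (real_cstar_subalgebra (slice_functions_valued \<real> K) (slice_algebra K) \<and>
      mult_commutative (slice_functions_valued \<real> K) (slice_algebra K)) \<and>
    (\<forall>j\<in>imag_sphere.
      slice_cstar_subalgebra j (slice_functions_valued (slice_plane j) K) (slice_algebra K) \<and>
      mult_commutative (slice_functions_valued (slice_plane j) K) (slice_algebra K)) \<and>
    quat_cstar_subalgebra (circular_slice_functions K) (slice_algebra K)"
proof -
  interpret symmetric_compact K
    by unfold_locales (use assms in auto)
  interpret whole: slice_subalgebra K UNIV UNIV
    by unfold_locales auto
  interpret real: slice_subalgebra K "\<real> \<times> \<real>" \<real>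
    by unfold_locales (auto simp: subspace_Times subspace_Reals cq_mult_def cq_star_def qcnj_Reals)
  interpret circ: slice_subalgebra K "UNIV \<times> {0}" UNIV
    by unfold_locales (auto simp: subspace_Times cq_mult_def cq_star_def)
  \<comment> \<open>If values in \<open>A\<close> commute, both components of \<open>cq_mult\<close>
    are symmetric in the two stem values.\<close>
  have comm: "mult_commutative (slice_functions_valued A K) V"
    if A: "\<And>p q. p \<in> A \<Longrightarrow> q \<in> A \<Longrightarrow> p * q = q * p" for A
  proof -
    have "slice_mult K f g = slice_mult K g f"
      if "f \<in> slice_functions_valued A K" "g \<in> slice_functions_valued A K" for f g
      unfolding slice_mult_def
    proof (rule slice_of_cong)
      fix z assume "z \<in> K"
      with that show "cq_mult (stem_of K f z) (stem_of K g z) = cq_mult (stem_of K g z) (stem_of K f z)"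
        using A by (simp add: slice_functions_valued_def cq_mult_def add.commute)
    qed
    then show ?thesis
      by (simp add: mult_commutative_def slice_algebra_def)
  qed
  have valued: "slice_functions_valued A K = {f \<in> slice_functions K. \<forall>z\<in>K. stem_of K f z \<in> A \<times> A}" for A
    by (simp add: slice_functions_valued_def mem_Times_iff)
  have circular: "circular_slice_functions K =
      {f \<in> slice_functions K. \<forall>z\<in>K. stem_of K f z \<in> UNIV \<times> {0}}"
    by (simp add: circular_slice_functions_def mem_Times_iff)
  \<comment> \<open>Values in \<open>UNIV\<close> impose no condition, so the carrier is
    unchanged.\<close>
  have "whole.W = V"
    by (simp add: whole.W_def slice_algebra_def)
  then have "banach_cstar UNIV V"
    using whole.banach_cstar_W by simp
  moreover have "real_cstar_subalgebra (slice_functions_valued \<real> K) V"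
    using real.banach_cstar_W real.slice_of_in_W[OF real.stems_1]
    by (auto simp: real_cstar_subalgebra_def valued real.W_def slice_algebra_def const_slice_eq)
  moreover have "mult_commutative (slice_functions_valued \<real> K) V"
    by (intro comm quat_Reals_commute)
  moreover have "quat_cstar_subalgebra (circular_slice_functions K) V"
    using circ.banach_cstar_W circ.slice_of_in_W[OF circ.stems_1]
    by (auto simp: quat_cstar_subalgebra_def circular circ.W_def slice_algebra_def const_slice_eq)
  moreover have "slice_cstar_subalgebra j (slice_functions_valued (slice_plane j) K) V \<and>
      mult_commutative (slice_functions_valued (slice_plane j) K) V" if j: "j \<in> imag_sphere" for j
  proof
    note P = slice_plane_subspace[of j]
    interpret plane: slice_subalgebra K "slice_plane j \<times> slice_plane j" "slice_plane j"
      by unfold_locales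
        (use slice_plane_of_real[of 1 j] in \<open>auto simp: subspace_Times P subspace_0[OF P] cq_mult_def
          cq_star_def subspace_add[OF P] subspace_diff[OF P] subspace_neg[OF P]
          slice_plane_mult(1)[OF j] slice_plane_qcnj[OF j]\<close>)
    show "mult_commutative (slice_functions_valued (slice_plane j) K) V"
      by (rule comm[OF slice_plane_mult(2)[OF j]])
    have "lscale V q u = rscale V u q"
      if q: "q \<in> slice_plane j" and u: "u \<in> slice_functions_valued (slice_plane j) K" for q u
    proof -
      have "u \<in> carrier plane.W"
        using u by (simp add: plane.W_def valued)
      then obtain F where F: "F \<in> plane.stems" "u = slice_of K F"
        by (rule plane.carrier_WE)
      \<comment> \<open>Both components of \<open>F z\<close> lie in the slice plane of
        \<open>q\<close>, so left and right scaling by \<open>q\<close> agree.\<close>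
      have "cq_mult (q, 0) (F z) = cq_mult (F z) (q, 0)" if "z \<in> K" for z
        using F(1) that slice_plane_mult(2)[OF j q]
        by (simp add: plane.stems_def cq_mult_def mem_Times_iff)
      then have "lscale plane.W q u = rscale plane.W u q"
        using F by (simp add: plane.W_ops cong: restrict_cong)
      then show ?thesis by (simp add: plane.W_def)
    qed
    then show "slice_cstar_subalgebra j (slice_functions_valued (slice_plane j) K) V"
      using plane.banach_cstar_W plane.slice_of_in_W[OF plane.stems_1]
      by (auto simp: slice_cstar_subalgebra_def valued plane.W_def slice_algebra_def const_slice_eq)
  qed
  ultimately show ?thesis by blast
qed

end
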